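(* Let $\mathbf{X}=\{X_t\}_{t\ge0}$ be an isotropic Lévy process in $\mathbb{R}^d$ with radial characteristic exponent $\psi$, and suppose that there are constants $C_0>0$ and $\alpha\in(0,2)$ such that $$C_0^{-1}\psi(x)\le\psi(y)\le C_0\left(\frac{y}{x}\right)^{\alpha}\psi(x),\qquad 1<x<y.$$ Assume also that the function $h$ associated with $\mathbf{X}$ is not Lebesgue integrable around zero. Then there exists a constant $C>0$ such that for every non-empty open set $\Omega\subset\mathbb{R}^d$ of finite Lebesgue measure $|\Omega|$ and finite perimeter $\mathrm{Per}(\Omega)$ (the constant $C$ not depending on $\Omega$), for all $t>0$ small enough (how small may depend on $\Omega$), $$H(t)\ge C\,t\,\mathrm{Per}(\Omega)\int_{h^{-1}(1/t)}^{R}h(r)\,dr,$$ where $R=2|\Omega|/\mathrm{Per}(\Omega)$ and $H(t)=\int_\Omega\mathbb{P}_x(X_t\in\Omega^c)\,dx$.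
   Context: A Lévy process $\mathbf{X}=\{X_t\}_{t\ge0}$ in $\mathbb{R}^d$ is a càdlàg process with stationary independent increments; under $\mathbb{P}$ it starts at $X_0=0$, and $\mathbb{P}_x$ denotes the law of the process started at $x$. Its characteristic exponent $\psi$ is defined by $\mathbb{E}e^{i\langle X_t,\xi\rangle}=e^{-t\psi(\xi)}$. The process is isotropic if the distribution of $X_t$ is rotationally invariant for each $t>0$; then $$\psi(x)=\eta\|x\|^2+\int_{\mathbb{R}^d}(1-\cos\langle x,y\rangle)\,\nu(dy)$$ with $\eta\ge0$ and a rotationally invariant Lévy measure $\nu$ ($\nu(\{0\})=0$, $\int(1\wedge\|y\|^2)\,\nu(dy)<\infty$). Thus $\psi$ is radial, and one writes $\psi(r)$ for $\psi(x)$ with $\|x\|=r$. The function $h$ associated with an isotropic Lévy process is, for $r>0$, $$h(r)=\eta r^{-2}+\int_{\mathbb{R}^d}\left(1\wedge\|y\|^2r^{-2}\right)\nu(dy).$$ It is decreasing, and $h^{-1}$ is its inverse: $h^{-1}(u)=\sup\{r>0:h(r)\ge u\}$ for $u>0$. The perimeter of a measurable set $\Omega\subset\mathbb{R}^d$ is $$\mathrm{Per}(\Omega)=\sup\left\{\int_{\mathbb{R}^d}\mathbf{1}_\Omega(x)\,\mathrm{div}\,\phi(x)\,dx:\ \phi\in C_c^1(\mathbb{R}^d,\mathbb{R}^d),\ \|\phi\|_\infty\le1\right\}.$$ A non-empty open set of finite measure has $\mathrm{Per}(\Omega)>0$. *)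

theory Defs
  imports "HOL-Probability.Probability"
begin

definition cadlag :: "(real \<Rightarrow> 'v::topological_space) \<Rightarrow> bool" where
  "cadlag f \<longleftrightarrow>
     (\<forall>t\<ge>0. (f \<longlongrightarrow> f t) (at_right t)) \<and> (\<forall>t>0. \<exists>l. (f \<longlongrightarrow> l) (at_left t))"

text \<open>The time parameter ranges over the nonnegative reals; \<open>X t\<close> for \<open>t < 0\<close> is irrelevant.\<close>

locale levy_process = prob_space +
  fixes X :: "real \<Rightarrow> 'a \<Rightarrow> 'v::euclidean_space"
  assumes random_variable: "t \<ge> 0 \<Longrightarrow> X t \<in> borel_measurable M"
    and start_zero: "AE \<omega> in M. X 0 \<omega> = 0"
    and cadlag_paths: "AE \<omega> in M. cadlag (\<lambda>t. X t \<omega>)"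
    and stationary_increments:
      "s \<ge> 0 \<Longrightarrow> t \<ge> 0 \<Longrightarrow>
         distr M borel (\<lambda>\<omega>. X (s + t) \<omega> - X s \<omega>) = distr M borel (\<lambda>\<omega>. X t \<omega> - X 0 \<omega>)"
    and independent_increments:
      "\<tau> 0 \<ge> 0 \<Longrightarrow> (\<And>i. i < n \<Longrightarrow> \<tau> i < \<tau> (Suc i)) \<Longrightarrow>
         indep_vars (\<lambda>_. borel) (\<lambda>i \<omega>. X (\<tau> (Suc i)) \<omega> - X (\<tau> i) \<omega>) {..<n::nat}"

text \<open>Invariance is required under the full orthogonal group. In dimension at least two this is
  the same as invariance under proper rotations; in dimension one it is symmetry.\<close>

definition rotation_invariant :: "'v::euclidean_space measure \<Rightarrow> bool" where
  "rotation_invariant \<mu> \<longleftrightarrow> (\<forall>T. orthogonal_transformation T \<longrightarrow> distr \<mu> borel T = \<mu>)"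

definition isotropic :: "'w measure \<Rightarrow> (real \<Rightarrow> 'w \<Rightarrow> 'v::euclidean_space) \<Rightarrow> bool" where
  "isotropic M X \<longleftrightarrow> (\<forall>t>0. rotation_invariant (distr M borel (X t)))"

text \<open>Requiring the identity for all times determines the exponent uniquely.\<close>

definition characteristic_exponent ::
    "'w measure \<Rightarrow> (real \<Rightarrow> 'w \<Rightarrow> 'v::euclidean_space) \<Rightarrow> ('v \<Rightarrow> complex) \<Rightarrow> bool" where
  "characteristic_exponent M X \<psi> \<longleftrightarrow>
     (\<forall>t\<ge>0. \<forall>\<xi>. (LINT \<omega>|M. exp (\<i> * complex_of_real (X t \<omega> \<bullet> \<xi>))) = exp (- (complex_of_real t * \<psi> \<xi>)))"

definition levy_measure :: "'v::euclidean_space measure \<Rightarrow> bool" where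
  "levy_measure \<nu> \<longleftrightarrow> sets \<nu> = sets borel \<and> emeasure \<nu> {0} = 0 \<and>
     integrable \<nu> (\<lambda>y. min 1 ((norm y)\<^sup>2))"

text \<open>\<open>(\<eta>, \<nu>)\<close> is the (unique) Gaussian coefficient and Levy measure in the Levy--Khintchine
  representation of the exponent \<open>\<psi>\<close> of an isotropic process.\<close>

definition isotropic_levy_khintchine ::
    "real \<Rightarrow> 'v::euclidean_space measure \<Rightarrow> ('v \<Rightarrow> real) \<Rightarrow> bool" where
  "isotropic_levy_khintchine \<eta> \<nu> \<psi> \<longleftrightarrow>
     \<eta> \<ge> 0 \<and> levy_measure \<nu> \<and> rotation_invariant \<nu> \<and>
     (\<forall>x. \<psi> x = \<eta> * (norm x)\<^sup>2 + (LINT y|\<nu>. 1 - cos (x \<bullet> y)))"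

definition levy_h :: "real \<Rightarrow> 'v::euclidean_space measure \<Rightarrow> real \<Rightarrow> real" where
  "levy_h \<eta> \<nu> r = \<eta> / r\<^sup>2 + (LINT y|\<nu>. min 1 ((norm y)\<^sup>2 / r\<^sup>2))"

definition levy_h_inv :: "real \<Rightarrow> 'v::euclidean_space measure \<Rightarrow> real \<Rightarrow> real" where
  "levy_h_inv \<eta> \<nu> u = Sup {r. r > 0 \<and> levy_h \<eta> \<nu> r \<ge> u}"

definition C1 :: "('v::euclidean_space \<Rightarrow> 'v) \<Rightarrow> bool" where
  "C1 \<phi> \<longleftrightarrow> (\<exists>\<phi>'. (\<forall>x. (\<phi> has_derivative blinfun_apply (\<phi>' x)) (at x)) \<and> continuous_on UNIV \<phi>')"

definition divergence :: "('v::euclidean_space \<Rightarrow> 'v) \<Rightarrow> 'v \<Rightarrow> real" where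
  "divergence \<phi> x = (\<Sum>b\<in>Basis. frechet_derivative \<phi> (at x) b \<bullet> b)"

definition perimeter :: "'v::euclidean_space set \<Rightarrow> ereal" where
  "perimeter \<Omega> =
     (SUP \<phi>\<in>{\<phi>. C1 \<phi> \<and> compact (closure {x. \<phi> x \<noteq> 0}) \<and> (\<forall>x. norm (\<phi> x) \<le> 1)}.
        ereal (LINT x|lborel. indicator \<Omega> x * divergence \<phi> x))"

text \<open>The law of \<open>X t\<close> for the process started at \<open>x\<close>.\<close>

definition law_from ::
    "'w measure \<Rightarrow> (real \<Rightarrow> 'w \<Rightarrow> 'v::euclidean_space) \<Rightarrow> 'v \<Rightarrow> real \<Rightarrow> 'v measure" where
  "law_from M X x t = distr M borel (\<lambda>\<omega>. x + X t \<omega>)"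

definition heat_loss ::
    "'w measure \<Rightarrow> (real \<Rightarrow> 'w \<Rightarrow> 'v::euclidean_space) \<Rightarrow> 'v set \<Rightarrow> real \<Rightarrow> real" where
  "heat_loss M X \<Omega> t = (LINT x:\<Omega>|lborel. measure (law_from M X x t) (- \<Omega>))"

end

(*
  Write mu for the law of X_t and D(y) = |{x in Omega. x + y notin Omega}|, so that H(t) is the
  mu-average of D.  Testing the increments of the indicator of Omega along y against a nearly
  optimal field Phi in the definition of the perimeter gives
    2 D(y) >= (integral over Omega of <DPhi(x) y, y> dx) / |y| - eps |Omega| |y|
  for small y, and averaging the quadratic form over the rotation invariant law replaces it by its
  trace: for every small delta,  H(t) >= c Per(Omega) E[|X_t|; |X_t| < delta].

  For s uniform in [0,1] the average of 1 - cos(s z) is comparable to min(1, z^2).  Integrating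
  this against nu compares h(r) with the average of psi(s/r); integrating it against mu compares
  E min(1, |X_t|^2/r^2) with the average of 1 - exp(-t psi(s/r)).  Hence
  t h(r) <= C E min(1, |X_t|^2/r^2) as soon as t h(r) <= 1, with a converse bound for all r.
  Integrating in r from h^{-1}(1/t) to delta bounds t times the integral of h by
  E[|X_t|; |X_t| < delta] + O(t), and since h is not integrable at 0 all terms O(t) are absorbed.
*)

theory Submission
  imports Defs
begin

section \<open>Averages of cosines and the function \<open>h\<close>\<close>

text \<open>The mean over s is taken because 1 - cos z vanishes at every multiple of 2 pi and so has
  no pointwise lower bound by min(1, z^2); its mean 1 - sin z / z vanishes only at the origin. No
  density or regularity of either measure enters: both are seen only through averages of cosines.
  The cutoff h^{-1}(1/t) is where t h(r) <= 1 begins, that is, the range of r in which 1 - exp(-t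
  psi(s/r)) is still comparable to t psi(s/r). The constant may not depend on Omega, although the
  test field, eps, delta and the integral of h over [delta, R] all do. These choices are made before
  t, and each of them costs only t times a number fixed by Omega, so they influence how small t must
  be and nothing else. The constant that survives is a product of numerical factors and two powers
  of the dimension: one from replacing a norm by its coordinates, one from replacing a quadratic
  form by its trace.\<close>

lemma sin_le_quintic:
  fixes z :: real
  assumes "0 \<le> z"
  shows "sin z \<le> z - z ^ 3 / 6 + z ^ 5 / 120"
proof -
  have s: "(\<Sum>m<5. sin_coeff m * z ^ m) = z - z ^ 3 / 6"
  proof -
    have "{..<5::nat} = {0, 1, 2, 3, 4}" by auto
    then show ?thesis by (simp add: sin_coeff_def fact_numeral)
  qed
  have "\<bar>sin z - (z - z ^ 3 / 6)\<bar> \<le> z ^ 5 / 120"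
    using Maclaurin_sin_bound[of z 5] assms unfolding s by (simp add: fact_numeral divide_simps)
  then show ?thesis by linarith
qed

text \<open>The mean of 1 - cos (s z) over s in [0,1] is 1 - sin z / z. By evenness z may be taken
  positive; up to 2 the Taylor polynomial of \<open>sin\<close> decides, beyond 2 the trivial bound
  sin z / z <= 1/2 suffices.\<close>

lemma one_minus_sinc_ge:
  fixes z :: real
  assumes "z \<noteq> 0"
  shows "min 1 (z\<^sup>2) / 8 \<le> 1 - sin z / z"
proof -
  have pos: "min 1 (w\<^sup>2) / 8 \<le> 1 - sin w / w" if w: "0 < w" for w :: real
  proof (cases "w \<le> 2")
    case True
    have "sin w / w \<le> (w - w ^ 3 / 6 + w ^ 5 / 120) / w"
      using sin_le_quintic[of w] w by (intro divide_right_mono) auto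
    also have "\<dots> = 1 - w\<^sup>2 / 6 + w\<^sup>2 * w\<^sup>2 / 120"
      using w by (simp add: field_simps eval_nat_numeral)
    finally have 1: "sin w / w \<le> 1 - w\<^sup>2 / 6 + w\<^sup>2 * w\<^sup>2 / 120" .
    \<comment> \<open>The quartic term costs at most w^2/30, and 1/6 - 1/30 = 2/15 exceeds
      1/8.\<close>
    have "w\<^sup>2 \<le> 2\<^sup>2" using True w by (intro power_mono) auto
    then have "w\<^sup>2 * w\<^sup>2 \<le> w\<^sup>2 * 4" by (intro mult_left_mono) auto
    then have "w\<^sup>2 / 8 \<le> 1 - sin w / w" using 1 zero_le_power2[of w] by linarith
    moreover have "min 1 (w\<^sup>2) / 8 \<le> w\<^sup>2 / 8" by simp
    ultimately show ?thesis by linarith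
  next
    case False
    have "sin w / w \<le> 1 / w" using w by (intro divide_right_mono) auto
    also have "\<dots> \<le> 1 / 2" using False by (intro divide_left_mono) auto
    finally have "sin w / w \<le> 1 / 2" .
    moreover have "min 1 (w\<^sup>2) \<le> 1" by simp
    ultimately show ?thesis by linarith
  qed
  show ?thesis
    using pos[of z] pos[of "-z"] assms by (cases "0 < z") auto
qed

lemma one_minus_cos_le:
  fixes z :: real
  shows "1 - cos z \<le> 2 * min 1 (z\<^sup>2)"
proof -
  have "1 - cos z = 2 * (sin (z / 2))\<^sup>2"
    using cos_double_sin[of "z/2"] by simp
  moreover have "(sin (z / 2))\<^sup>2 \<le> (z / 2)\<^sup>2"
    using abs_sin_x_le_abs_x[of "z/2"] by (metis abs_le_square_iff)
  ultimately have "1 - cos z \<le> z\<^sup>2 / 2" by (simp add: power_divide)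
  moreover have "1 - cos z \<le> 2" using cos_ge_minus_one[of z] by linarith
  ultimately show ?thesis by (smt (verit) min_def zero_le_power2 field_sum_of_halves)
qed

text \<open>As a density on the whole line it makes s lie in [0,1] only almost everywhere, while
  integrands must be Borel on all reals. Hence the form \<open>\<psi> (\<bar>s\<bar> / r)\<close>
  below: the hypotheses control \<open>\<psi>\<close> at nonnegative arguments only.\<close>

abbreviation unit_interval :: "real measure" where
  "unit_interval \<equiv> density lborel (\<lambda>s. ennreal (indicator {0..1} s))"

lemma prob_space_unit_interval: "prob_space unit_interval"
proof
  have "emeasure unit_interval UNIV = (\<integral>\<^sup>+ s. indicator {0..1::real} s \<partial>lborel)"
    by (subst emeasure_density) (auto intro!: nn_integral_cong simp: ennreal_indicator)
  then show "emeasure unit_interval (space unit_interval) = 1" by simp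
qed

lemma AE_unit_interval: "AE s in unit_interval. 0 \<le> s \<and> s \<le> 1"
  by (subst AE_density) (auto simp: indicator_def)

lemma integral_unit_interval_one_minus_cos:
  fixes z :: real
  assumes "z \<noteq> 0"
  shows "(LINT s|unit_interval. 1 - cos (s * z)) = 1 - sin z / z"
proof -
  have "(LINT s|unit_interval. 1 - cos (s * z)) = (LINT s|lborel. (1 - cos (s * z)) * indicator {0..1} s)"
    by (subst integral_density) (auto simp: mult.commute)
  also have "\<dots> = (1 - sin (1 * z) / z) - (0 - sin (0 * z) / z)"
  proof (rule integral_FTC_Icc_real)
    show "((\<lambda>s. s - sin (s * z) / z) has_real_derivative 1 - cos (x * z)) (at x)" for x
      using assms by (auto intro!: derivative_eq_intros)
  qed auto
  finally show ?thesis by simp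
qed

lemma integral_unit_interval_square: "(LINT s|unit_interval. s\<^sup>2) = 1 / 3"
proof -
  have "(LINT s|unit_interval. s\<^sup>2) = (LINT s|lborel. s\<^sup>2 * indicator {0..1} s)"
    by (subst integral_density) (auto simp: mult.commute)
  also have "\<dots> = 1 ^ 3 / 3 - 0 ^ 3 / 3"
    by (rule integral_FTC_Icc_real) (auto intro!: derivative_eq_intros)
  finally show ?thesis by simp
qed

lemma integral_unit_interval_one_minus_cos_ge:
  fixes z :: real
  shows "min 1 (z\<^sup>2) / 8 \<le> (LINT s|unit_interval. 1 - cos (s * z))"
proof (cases "z = 0")
  case False
  then show ?thesis
    using one_minus_sinc_ge[of z] integral_unit_interval_one_minus_cos[of z] by simp
qed simp

lemma one_minus_cos_scaled_le:
  fixes s z w :: real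
  assumes "0 \<le> s" "s \<le> 1" "\<bar>z\<bar> \<le> \<bar>w\<bar>"
  shows "1 - cos (s * z) \<le> 2 * min 1 (w\<^sup>2)"
proof -
  have "\<bar>s * z\<bar> \<le> 1 * \<bar>w\<bar>"
    unfolding abs_mult using assms by (intro mult_mono) auto
  then have "(s * z)\<^sup>2 \<le> w\<^sup>2" by (simp add: abs_le_square_iff)
  then show ?thesis using one_minus_cos_le[of "s * z"] by linarith
qed

text \<open>Subadditivity of x -> min 1 x on the nonnegative reals. Coordinates are introduced
  because a cosine in direction b sees only the component of y along b.\<close>

lemma sum_min_coordinates_ge:
  fixes y :: "'v::euclidean_space"
  shows "min 1 ((norm y)\<^sup>2 / r\<^sup>2) \<le> (\<Sum>b\<in>Basis. min 1 ((y \<bullet> b / r)\<^sup>2))"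
proof -
  have sub: "min 1 (\<Sum>b\<in>B. f b) \<le> (\<Sum>b\<in>B. min 1 (f b))" if "finite B" "\<And>b. 0 \<le> f b" for B and f :: "'v \<Rightarrow> real"
    using that(1)
  proof induction
    case (insert b B)
    have "min 1 (f b + (\<Sum>b\<in>B. f b)) \<le> min 1 (f b) + min 1 (\<Sum>b\<in>B. f b)"
      using that(2)[of b] sum_nonneg[of B f, OF that(2)] by (auto simp: min_def)
    then show ?case using insert by simp
  qed simp
  have "(norm y)\<^sup>2 / r\<^sup>2 = (\<Sum>b\<in>Basis. (y \<bullet> b / r)\<^sup>2)"
  proof -
    have "(norm y)\<^sup>2 = (\<Sum>b\<in>Basis. (y \<bullet> b)\<^sup>2)"
      unfolding power2_norm_eq_inner by (subst euclidean_inner) (simp add: power2_eq_square)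
    then show ?thesis by (simp add: power_divide sum_divide_distrib)
  qed
  then show ?thesis using sub[of Basis "\<lambda>b. (y \<bullet> b / r)\<^sup>2"] by simp
qed

text \<open>Used twice: integrated against \<open>\<nu>\<close> it bounds h by averages of
  \<open>\<psi>\<close>, integrated against the law of \<open>X t\<close> it bounds the truncated
  second moment by averages of 1 - exp(-t psi). The factor 8 is the one of the sinc bound.\<close>

lemma truncated_square_le_sum_average:
  fixes y :: "'v::euclidean_space"
  shows "min 1 ((norm y)\<^sup>2 / r\<^sup>2)
    \<le> 8 * (\<Sum>b\<in>Basis. LINT s|unit_interval. 1 - cos (s * (b \<bullet> y / r)))"
proof -
  have "(\<Sum>b\<in>Basis. min 1 ((y \<bullet> b / r)\<^sup>2))
      \<le> (\<Sum>b\<in>Basis. 8 * (LINT s|unit_interval. 1 - cos (s * (b \<bullet> y / r))))"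
    using integral_unit_interval_one_minus_cos_ge[of "y \<bullet> b / r" for b]
    by (intro sum_mono) (auto simp: inner_commute field_simps)
  then show ?thesis using sum_min_coordinates_ge[of y r] by (simp add: sum_distrib_left)
qed

text \<open>Makes Fubini available although \<open>\<nu>\<close> may have infinite mass near the
  origin: the sets where min 1 |y|^2 is at least 1/(n+1) are finite by Markov's inequality, and the
  origin, a null set, completes the cover.\<close>

lemma sigma_finite_levy_measure:
  fixes \<nu> :: "'v::euclidean_space measure"
  assumes "levy_measure \<nu>"
  shows "sigma_finite_measure \<nu>"
proof
  have [measurable_cong]: "sets \<nu> = sets borel" and z: "emeasure \<nu> {0} = 0"
    and int: "integrable \<nu> (\<lambda>y. min 1 ((norm y)\<^sup>2))"
    using assms by (auto simp: levy_measure_def)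
  have sp: "space \<nu> = UNIV" using sets_eq_imp_space_eq[OF \<open>sets \<nu> = sets borel\<close>] by simp
  define A where "A n = {y::'v. inverse (real (Suc n)) \<le> min 1 ((norm y)\<^sup>2)}" for n
  have A: "A n \<in> sets \<nu>" for n unfolding A_def by simp
  have fin: "emeasure \<nu> (A n) \<noteq> \<infinity>" for n
  proof -
    have "emeasure \<nu> (A n) \<le> (\<integral>\<^sup>+ y. ennreal (real (Suc n)) * ennreal (min 1 ((norm y)\<^sup>2)) \<partial>\<nu>)"
    proof (subst nn_integral_indicator[symmetric, OF A], intro nn_integral_mono)
      fix y
      have "indicator (A n) y \<le> real (Suc n) * min 1 ((norm y)\<^sup>2)"
        by (auto simp: A_def indicator_def field_simps)
      then show "indicator (A n) y \<le> ennreal (real (Suc n)) * ennreal (min 1 ((norm y)\<^sup>2))"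
        by (subst ennreal_mult[symmetric]) (auto simp: ennreal_indicator[symmetric] intro!: ennreal_leI)
    qed
    also have "\<dots> = ennreal (real (Suc n)) * (\<integral>\<^sup>+ y. ennreal (min 1 ((norm y)\<^sup>2)) \<partial>\<nu>)"
      by (rule nn_integral_cmult) measurable
    also have "\<dots> < \<infinity>"
      using int by (auto simp: integrable_iff_bounded ennreal_mult_less_top)
    finally show ?thesis by simp
  qed
  have cov: "y = 0 \<or> (\<exists>n. y \<in> A n)" for y
  proof (cases "y = 0")
    case False
    then have "0 < min 1 ((norm y)\<^sup>2)" by auto
    then obtain n where "inverse (real (Suc n)) < min 1 ((norm y)\<^sup>2)" using reals_Archimedean by blast
    then show ?thesis by (auto simp: A_def intro: less_imp_le)
  qed simp
  show "\<exists>F. countable F \<and> F \<subseteq> sets \<nu> \<and> \<Union> F = space \<nu> \<and> (\<forall>a\<in>F. emeasure \<nu> a \<noteq> \<infinity>)"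
  proof (intro exI[of _ "insert {0} (range A)"] conjI)
    show "\<Union> (insert {0} (range A)) = space \<nu>" using cov unfolding sp by blast
  qed (use A fin z in auto)
qed

lemma integrable_levy_min:
  fixes \<nu> :: "'v::euclidean_space measure"
  assumes "levy_measure \<nu>" "0 < r"
  shows "integrable \<nu> (\<lambda>y. min 1 ((norm y)\<^sup>2 / r\<^sup>2))"
proof (rule Bochner_Integration.integrable_bound)
  have [measurable_cong]: "sets \<nu> = sets borel" and int: "integrable \<nu> (\<lambda>y. min 1 ((norm y)\<^sup>2))"
    using assms by (auto simp: levy_measure_def)
  \<comment> \<open>The summand 1 / r^2 dominates inside the unit ball, the summand 1 outside
    it.\<close>
  show "integrable \<nu> (\<lambda>y. (1 + 1 / r\<^sup>2) * min 1 ((norm y)\<^sup>2))"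
    using int by simp
  show "(\<lambda>y. min 1 ((norm y)\<^sup>2 / r\<^sup>2)) \<in> borel_measurable \<nu>" by measurable
  show "AE y in \<nu>. norm (min 1 ((norm y)\<^sup>2 / r\<^sup>2)) \<le> norm ((1 + 1 / r\<^sup>2) * min 1 ((norm y)\<^sup>2))"
  proof (rule AE_I2)
    fix y :: 'v
    have "min 1 ((norm y)\<^sup>2 / r\<^sup>2) \<le> (1 + 1 / r\<^sup>2) * min 1 ((norm y)\<^sup>2)"
    proof (cases "(norm y)\<^sup>2 \<le> 1")
      case True
      then show ?thesis by (simp add: algebra_simps min.coboundedI2)
    next
      case False
      then show ?thesis by (simp add: min.coboundedI1)
    qed
    then show "norm (min 1 ((norm y)\<^sup>2 / r\<^sup>2)) \<le> norm ((1 + 1 / r\<^sup>2) * min 1 ((norm y)\<^sup>2))"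
      by auto
  qed
qed

section \<open>Monotonicity and measurability of h\<close>

lemma levy_h_nonneg: "0 \<le> \<eta> \<Longrightarrow> 0 \<le> levy_h \<eta> \<nu> r"
  unfolding levy_h_def by (intro add_nonneg_nonneg Bochner_Integration.integral_nonneg) auto

lemma levy_h_antimono:
  assumes "levy_measure \<nu>" "0 \<le> \<eta>" "0 < r" "r \<le> s"
  shows "levy_h \<eta> \<nu> s \<le> levy_h \<eta> \<nu> r"
proof -
  have sq: "r\<^sup>2 \<le> s\<^sup>2" using assms by (intro power_mono) auto
  show ?thesis unfolding levy_h_def
  proof (intro add_mono integral_mono integrable_levy_min)
    show "\<eta> / s\<^sup>2 \<le> \<eta> / r\<^sup>2" using sq assms by (intro divide_left_mono) auto
    show "min 1 ((norm y)\<^sup>2 / s\<^sup>2) \<le> min 1 ((norm y)\<^sup>2 / r\<^sup>2)" for y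
    proof -
      have "(norm y)\<^sup>2 / s\<^sup>2 \<le> (norm y)\<^sup>2 / r\<^sup>2" using sq assms by (intro divide_left_mono) auto
      then show ?thesis by auto
    qed
  qed (use assms in auto)
qed

lemma levy_h_measurable:
  assumes "levy_measure \<nu>"
  shows "levy_h \<eta> \<nu> \<in> borel_measurable borel"
proof -
  interpret sigma_finite_measure \<nu> using sigma_finite_levy_measure assms .
  have [measurable_cong]: "sets \<nu> = sets borel" using assms by (auto simp: levy_measure_def)
  show ?thesis unfolding levy_h_def[abs_def] by measurable
qed

section \<open>Comparison of h with the characteristic exponent\<close>

lemma integrable_levy_one_minus_cos:
  fixes \<nu> :: "'v::euclidean_space measure"
  assumes \<nu>: "levy_measure \<nu>" and "0 < r" "0 \<le> s" "s \<le> 1" "norm e = 1"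
  shows "integrable \<nu> (\<lambda>y. 1 - cos (s * (e \<bullet> y / r)))"
    and "(LINT y|\<nu>. 1 - cos (s * (e \<bullet> y / r))) \<le> 2 * (LINT y|\<nu>. min 1 ((norm y)\<^sup>2 / r\<^sup>2))"
proof -
  have [measurable_cong]: "sets \<nu> = sets borel" using \<nu> by (auto simp: levy_measure_def)
  have le: "1 - cos (s * (e \<bullet> y / r)) \<le> 2 * min 1 ((norm y)\<^sup>2 / r\<^sup>2)" for y
  proof -
    have "\<bar>e \<bullet> y / r\<bar> \<le> \<bar>norm y / r\<bar>"
      using Cauchy_Schwarz_ineq2[of e y] assms by (simp add: divide_right_mono)
    then show ?thesis
      using one_minus_cos_scaled_le[of s "e \<bullet> y / r" "norm y / r"] assms by (simp add: power_divide)
  qed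
  have i: "integrable \<nu> (\<lambda>y. 2 * min 1 ((norm y)\<^sup>2 / r\<^sup>2))"
    using integrable_levy_min[OF \<nu> \<open>0 < r\<close>] by simp
  show I: "integrable \<nu> (\<lambda>y. 1 - cos (s * (e \<bullet> y / r)))"
    by (rule Bochner_Integration.integrable_bound[OF i]) (use le in \<open>auto simp: abs_le_iff intro!: AE_I2 order_trans[OF le]\<close>)
  show "(LINT y|\<nu>. 1 - cos (s * (e \<bullet> y / r))) \<le> 2 * (LINT y|\<nu>. min 1 ((norm y)\<^sup>2 / r\<^sup>2))"
    using integral_mono[OF I i le] by simp
qed

text \<open>The representation is read along the ray through a unit vector \<open>e\<close>. By
  radiality every \<open>e\<close> gives the same value, so later proofs pick one direction or sum
  over the basis as convenient.\<close>

lemma exponent_eq: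
  fixes \<nu> :: "'v::euclidean_space measure"
  assumes "isotropic_levy_khintchine \<eta> \<nu> (\<lambda>\<xi>. \<psi> (norm \<xi>))" "norm e = 1" "0 < r" "0 \<le> s"
  shows "\<psi> (s / r) = \<eta> / r\<^sup>2 * s\<^sup>2 + (LINT y|\<nu>. 1 - cos (s * (e \<bullet> y / r)))"
proof -
  have "\<psi> (norm ((s / r) *\<^sub>R e)) =
      \<eta> * (norm ((s / r) *\<^sub>R e))\<^sup>2 + (LINT y|\<nu>. 1 - cos (((s / r) *\<^sub>R e) \<bullet> y))"
    using assms(1) unfolding isotropic_levy_khintchine_def by blast
  then show ?thesis using assms(2-) by (simp add: power_divide mult.commute)
qed

text \<open>The factor 2 returns later: together with t h(r) <= 1 it places t psi(s/r) in
  [0,2].\<close>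

lemma exponent_bounds:
  fixes \<nu> :: "'v::euclidean_space measure"
  assumes rep: "isotropic_levy_khintchine \<eta> \<nu> (\<lambda>\<xi>. \<psi> (norm \<xi>))" and "0 < r" "0 \<le> s" "s \<le> 1"
  shows "0 \<le> \<psi> (s / r)" and "\<psi> (s / r) \<le> 2 * levy_h \<eta> \<nu> r"
proof -
  obtain e :: 'v where e: "norm e = 1" using nonempty_Basis norm_Basis by blast
  have \<nu>: "levy_measure \<nu>" and \<eta>: "0 \<le> \<eta>" using rep by (auto simp: isotropic_levy_khintchine_def)
  note eq = exponent_eq[OF rep e \<open>0 < r\<close> \<open>0 \<le> s\<close>]
  show "0 \<le> \<psi> (s / r)"
    unfolding eq using \<eta> by (intro add_nonneg_nonneg Bochner_Integration.integral_nonneg) auto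
  have "s\<^sup>2 \<le> 1" using assms by (simp add: power_le_one)
  then have "\<eta> / r\<^sup>2 * s\<^sup>2 \<le> \<eta> / r\<^sup>2 * 1" using \<eta> by (intro mult_left_mono) auto
  moreover have "0 \<le> \<eta> / r\<^sup>2" using \<eta> by auto
  ultimately show "\<psi> (s / r) \<le> 2 * levy_h \<eta> \<nu> r"
    unfolding eq levy_h_def using integrable_levy_one_minus_cos(2)[OF \<nu> assms(2-4) e] by simp
qed

lemma exponent_measurable:
  fixes \<nu> :: "'v::euclidean_space measure"
  assumes rep: "isotropic_levy_khintchine \<eta> \<nu> (\<lambda>\<xi>. \<psi> (norm \<xi>))" and "0 < r"
  shows "(\<lambda>s. \<psi> (\<bar>s\<bar> / r)) \<in> borel_measurable borel"
proof -
  obtain e :: 'v where e: "norm e = 1" using nonempty_Basis norm_Basis by blast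
  have \<nu>: "levy_measure \<nu>" using rep by (auto simp: isotropic_levy_khintchine_def)
  then have [measurable_cong]: "sets \<nu> = sets borel" by (auto simp: levy_measure_def)
  interpret sigma_finite_measure \<nu> using sigma_finite_levy_measure[OF \<nu>] .
  have "(\<lambda>s. \<psi> (\<bar>s\<bar> / r)) = (\<lambda>s. \<eta> / r\<^sup>2 * \<bar>s\<bar>\<^sup>2 + (LINT y|\<nu>. 1 - cos (\<bar>s\<bar> * (e \<bullet> y / r))))"
    using exponent_eq[OF rep e \<open>0 < r\<close>, of "\<bar>s\<bar>" for s] by auto
  moreover have "(\<lambda>s. \<eta> / r\<^sup>2 * \<bar>s\<bar>\<^sup>2 + (LINT y|\<nu>. 1 - cos (\<bar>s\<bar> * (e \<bullet> y / r)))) \<in> borel_measurable borel"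
    by measurable
  ultimately show ?thesis by simp
qed

text \<open>After exchanging the integrals over s and \<open>\<nu>\<close>, each basis direction
  contributes the same average of \<open>\<psi>\<close>, because \<open>\<psi>\<close> is radial;
  this produces the factor DIM.\<close>

lemma levy_h_le_average:
  fixes \<nu> :: "'v::euclidean_space measure"
  assumes rep: "isotropic_levy_khintchine \<eta> \<nu> (\<lambda>\<xi>. \<psi> (norm \<xi>))" and r: "0 < r"
  shows "levy_h \<eta> \<nu> r \<le> 8 * real DIM('v) * (LINT s|unit_interval. \<psi> (\<bar>s\<bar> / r))"
proof -
  have \<nu>: "levy_measure \<nu>" and \<eta>: "0 \<le> \<eta>" using rep by (auto simp: isotropic_levy_khintchine_def)
  have [measurable_cong]: "sets \<nu> = sets borel" using \<nu> by (auto simp: levy_measure_def)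
  interpret N: sigma_finite_measure \<nu> using sigma_finite_levy_measure[OF \<nu>] .
  interpret U: prob_space unit_interval by (rule prob_space_unit_interval)
  interpret P: pair_sigma_finite unit_interval \<nu> ..
  let ?k = "\<lambda>b y. LINT s|unit_interval. 1 - cos (s * (b \<bullet> y / r))"
  have iU: "integrable unit_interval (\<lambda>s. 1 - cos (s * z))" for z :: real
  proof (rule U.integrable_const_bound[of _ 2])
    have "norm (1 - cos (s * z)) \<le> 2" for s
      using cos_ge_minus_one[of "s * z"] cos_le_one[of "s * z"] by auto
    then show "AE s in unit_interval. norm (1 - cos (s * z)) \<le> 2" by simp
  qed measurable
  \<comment> \<open>A constant bound is not enough, as \<open>\<nu>\<close> may be infinite. For
    fixed s the integral over y is at most twice that of the truncated square, uniformly in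
    s.\<close>
  have prod: "integrable (unit_interval \<Otimes>\<^sub>M \<nu>) (\<lambda>(s, y). 1 - cos (s * (b \<bullet> y / r)))" if b: "b \<in> Basis" for b
  proof (rule P.Fubini_integrable)
    have nb: "norm b = 1" using b by simp
    show "integrable unit_interval (\<lambda>s. LINT y|\<nu>. norm (case (s, y) of (s, y) \<Rightarrow> 1 - cos (s * (b \<bullet> y / r))))"
      using AE_unit_interval
    proof (intro U.integrable_const_bound[of _ "2 * (LINT y|\<nu>. min 1 ((norm y)\<^sup>2 / r\<^sup>2))"], eventually_elim)
      case (elim s)
      have "0 \<le> (LINT y|\<nu>. 1 - cos (s * (b \<bullet> y / r)))" by (intro Bochner_Integration.integral_nonneg) auto
      then show ?case using integrable_levy_one_minus_cos(2)[OF \<nu> r _ _ nb, of s] elim by simp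
    qed measurable
    show "AE s in unit_interval. integrable \<nu> (\<lambda>y. case (s, y) of (s, y) \<Rightarrow> 1 - cos (s * (b \<bullet> y / r)))"
      using AE_unit_interval
    proof eventually_elim
      case (elim s)
      then show ?case using integrable_levy_one_minus_cos(1)[OF \<nu> r _ _ nb, of s] by simp
    qed
  qed measurable
  have avg: "(LINT s|unit_interval. \<psi> (\<bar>s\<bar> / r)) = \<eta> / (3 * r\<^sup>2) + (LINT y|\<nu>. ?k b y)"
    and ik: "integrable \<nu> (?k b)" if b: "b \<in> Basis" for b
  proof -
    have nb: "norm b = 1" using b by simp
    have i2: "integrable unit_interval (\<lambda>s. LINT y|\<nu>. 1 - cos (s * (b \<bullet> y / r)))"
      using P.integrable_fst'[OF prod[OF b]] by simp
    have i1: "integrable unit_interval (\<lambda>s. \<eta> / r\<^sup>2 * s\<^sup>2)"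
    proof (intro integrable_mult_right U.integrable_const_bound[of _ 1])
      show "AE s in unit_interval. norm (s\<^sup>2) \<le> 1"
        using AE_unit_interval by eventually_elim (auto simp: power_le_one)
    qed measurable
    have "(LINT s|unit_interval. \<psi> (\<bar>s\<bar> / r)) =
        (LINT s|unit_interval. \<eta> / r\<^sup>2 * s\<^sup>2 + (LINT y|\<nu>. 1 - cos (s * (b \<bullet> y / r))))"
    proof (rule integral_cong_AE)
      show "(\<lambda>s. \<psi> (\<bar>s\<bar> / r)) \<in> borel_measurable unit_interval"
        using exponent_measurable[OF rep r] by simp
      show "AE s in unit_interval. \<psi> (\<bar>s\<bar> / r) = \<eta> / r\<^sup>2 * s\<^sup>2 + (LINT y|\<nu>. 1 - cos (s * (b \<bullet> y / r)))"
        using AE_unit_interval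
      proof eventually_elim
        case (elim s)
        then show ?case using exponent_eq[OF rep nb r, of "\<bar>s\<bar>"] by simp
      qed
    qed measurable
    also have "\<dots> = \<eta> / r\<^sup>2 * (1 / 3) + (LINT s|unit_interval. LINT y|\<nu>. 1 - cos (s * (b \<bullet> y / r)))"
      by (subst Bochner_Integration.integral_add[OF i1 i2])
        (simp add: integral_unit_interval_square)
    also have "(LINT s|unit_interval. LINT y|\<nu>. 1 - cos (s * (b \<bullet> y / r))) = (LINT y|\<nu>. ?k b y)"
      using P.Fubini_integral[OF prod[OF b]] by simp
    finally show "(LINT s|unit_interval. \<psi> (\<bar>s\<bar> / r)) = \<eta> / (3 * r\<^sup>2) + (LINT y|\<nu>. ?k b y)" by simp
    show "integrable \<nu> (?k b)" using P.integrable_snd[OF prod[OF b]] by simp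
  qed
  have "min 1 ((norm y)\<^sup>2 / r\<^sup>2) \<le> 8 * (\<Sum>b\<in>Basis. ?k b y)" for y :: 'v
    by (rule truncated_square_le_sum_average)
  then have "(LINT y|\<nu>. min 1 ((norm y)\<^sup>2 / r\<^sup>2)) \<le> (LINT y|\<nu>. 8 * (\<Sum>b\<in>Basis. ?k b y))"
    using ik integrable_levy_min[OF \<nu> r] by (intro integral_mono) auto
  also have "\<dots> = 8 * (\<Sum>b\<in>Basis. LINT y|\<nu>. ?k b y)"
    using ik by (simp add: Bochner_Integration.integral_sum)
  also have "\<dots> = 8 * (\<Sum>b\<in>(Basis :: 'v set). (LINT s|unit_interval. \<psi> (\<bar>s\<bar> / r)) - \<eta> / (3 * r\<^sup>2))"
    using avg by simp
  also have "\<dots> = 8 * real DIM('v) * (LINT s|unit_interval. \<psi> (\<bar>s\<bar> / r)) - 8 / 3 * real DIM('v) * (\<eta> / r\<^sup>2)"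
    by (simp add: algebra_simps)
  finally have "levy_h \<eta> \<nu> r \<le> \<eta> / r\<^sup>2 + (8 * real DIM('v) * (LINT s|unit_interval. \<psi> (\<bar>s\<bar> / r)) - 8 / 3 * real DIM('v) * (\<eta> / r\<^sup>2))"
    by (simp add: levy_h_def)
  \<comment> \<open>The Gaussian part is averaged to a third of its size, since s^2 has mean 1/3;
    the factor 8 DIM more than restores it.\<close>
  moreover have "1 * (\<eta> / r\<^sup>2) \<le> 8 / 3 * real DIM('v) * (\<eta> / r\<^sup>2)"
  proof (intro mult_right_mono)
    have "1 \<le> real DIM('v)" using DIM_positive[where 'a = 'v] by linarith
    then show "1 \<le> 8 / 3 * real DIM('v)" by linarith
  qed (use \<eta> in auto)
  ultimately show ?thesis by linarith
qed

section \<open>Truncated moments of the law at a fixed time\<close>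

text \<open>One fixed time in isolation: \<open>\<mu>\<close> stands for the law of
  \<open>X t\<close> and is known only through its cosine transform.\<close>

locale levy_law = prob_space \<mu> for \<mu> :: "'v::euclidean_space measure" +
  fixes \<psi> :: "real \<Rightarrow> real" and \<eta> :: real and \<nu> :: "'v measure" and t :: real
  assumes sets_law [measurable_cong]: "sets \<mu> = sets borel"
    and t_nonneg: "0 \<le> t"
    and rep: "isotropic_levy_khintchine \<eta> \<nu> (\<lambda>\<xi>. \<psi> (norm \<xi>))"
    and char_cos: "\<And>\<xi>. (LINT y|\<mu>. cos (y \<bullet> \<xi>)) = exp (- (t * \<psi> (norm \<xi>)))"
begin

lemma integrable_truncated: "integrable \<mu> (\<lambda>y. min 1 ((norm y)\<^sup>2 / r\<^sup>2))"
  by (rule integrable_const_bound[of _ 1]) auto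

text \<open>The link between the law and the exponent. For fixed s the integral over y is the
  characteristic function at the point (s/r) e; the integrand is bounded by 2 on a product of
  probability spaces, so Fubini applies.\<close>

lemma average_cos:
  assumes r: "0 < r" and e: "norm e = 1"
  shows "(LINT y|\<mu>. LINT s|unit_interval. 1 - cos (s * (e \<bullet> y / r)))
      = (LINT s|unit_interval. 1 - exp (- (t * \<psi> (\<bar>s\<bar> / r))))"
    and "integrable \<mu> (\<lambda>y. LINT s|unit_interval. 1 - cos (s * (e \<bullet> y / r)))"
proof -
  interpret U: prob_space unit_interval by (rule prob_space_unit_interval)
  interpret P: pair_prob_space unit_interval \<mu> ..
  have bd: "norm (1 - cos x) \<le> 2" for x :: real
    using cos_ge_minus_one[of x] cos_le_one[of x] by auto
  have int: "integrable (unit_interval \<Otimes>\<^sub>M \<mu>) (\<lambda>(s, y). 1 - cos (s * (e \<bullet> y / r)))"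
    by (rule P.integrable_const_bound[of _ 2]) (use bd in \<open>auto intro!: AE_I2\<close>)
  have inner: "(LINT y|\<mu>. 1 - cos (s * (e \<bullet> y / r))) = 1 - exp (- (t * \<psi> (\<bar>s\<bar> / r)))" for s
  proof -
    have "(LINT y|\<mu>. cos (s * (e \<bullet> y / r))) = (LINT y|\<mu>. cos (y \<bullet> ((s / r) *\<^sub>R e)))"
      by (intro Bochner_Integration.integral_cong refl arg_cong[of _ _ cos]) (simp add: inner_commute)
    also have "\<dots> = exp (- (t * \<psi> (\<bar>s\<bar> / r)))"
      unfolding char_cos using e r by simp
    finally have *: "(LINT y|\<mu>. cos (s * (e \<bullet> y / r))) = exp (- (t * \<psi> (\<bar>s\<bar> / r)))" .
    have "integrable \<mu> (\<lambda>y. cos (s * (e \<bullet> y / r)))"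
      by (rule integrable_const_bound[of _ 1]) auto
    then have "(LINT y|\<mu>. 1 - cos (s * (e \<bullet> y / r))) = (LINT y|\<mu>. 1) - (LINT y|\<mu>. cos (s * (e \<bullet> y / r)))"
      by (intro Bochner_Integration.integral_diff) auto
    then show ?thesis unfolding * by (simp add: prob_space)
  qed
  show "(LINT y|\<mu>. LINT s|unit_interval. 1 - cos (s * (e \<bullet> y / r)))
      = (LINT s|unit_interval. 1 - exp (- (t * \<psi> (\<bar>s\<bar> / r))))"
    by (rule P.Fubini_integral[OF int, unfolded inner])
  show "integrable \<mu> (\<lambda>y. LINT s|unit_interval. 1 - cos (s * (e \<bullet> y / r)))"
    using P.integrable_snd[OF int] by simp
qed

lemma integrable_exponent_unit_interval:
  assumes r: "0 < r"
  shows "integrable unit_interval (\<lambda>s. \<psi> (\<bar>s\<bar> / r))"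
    and "integrable unit_interval (\<lambda>s. 1 - exp (- (t * \<psi> (\<bar>s\<bar> / r))))"
proof -
  interpret U: prob_space unit_interval by (rule prob_space_unit_interval)
  have m [measurable]: "(\<lambda>s. \<psi> (\<bar>s\<bar> / r)) \<in> borel_measurable borel"
    by (rule exponent_measurable[OF rep r])
  show "integrable unit_interval (\<lambda>s. \<psi> (\<bar>s\<bar> / r))"
  proof (rule U.integrable_const_bound[of _ "2 * levy_h \<eta> \<nu> r"])
    show "AE s in unit_interval. norm (\<psi> (\<bar>s\<bar> / r)) \<le> 2 * levy_h \<eta> \<nu> r"
      using AE_unit_interval by eventually_elim (use exponent_bounds[OF rep r] in auto)
  qed simp
  show "integrable unit_interval (\<lambda>s. 1 - exp (- (t * \<psi> (\<bar>s\<bar> / r))))"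
  proof (rule U.integrable_const_bound[of _ 1])
    show "AE s in unit_interval. norm (1 - exp (- (t * \<psi> (\<bar>s\<bar> / r)))) \<le> 1"
      using AE_unit_interval by eventually_elim (use exponent_bounds[OF rep r] t_nonneg in auto)
  qed simp
qed

text \<open>The factor 48 is 8 * 3 * 2: the sinc bound, the inequality x <= 3 (1 - exp(-x)) on
  [0,2], and the bound of 1 - cos by twice the truncated square.\<close>

lemma truncated_moment_ge:
  assumes r: "0 < r" and h: "t * levy_h \<eta> \<nu> r \<le> 1"
  shows "t * levy_h \<eta> \<nu> r \<le> 48 * real DIM('v) * (LINT y|\<mu>. min 1 ((norm y)\<^sup>2 / r\<^sup>2))"
proof -
  interpret U: prob_space unit_interval by (rule prob_space_unit_interval)
  obtain e :: 'v where e: "norm e = 1" using nonempty_Basis norm_Basis by blast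
  have "t * (LINT s|unit_interval. \<psi> (\<bar>s\<bar> / r)) = (LINT s|unit_interval. t * \<psi> (\<bar>s\<bar> / r))"
    by simp
  also have "\<dots> \<le> (LINT s|unit_interval. 3 * (1 - exp (- (t * \<psi> (\<bar>s\<bar> / r)))))"
  proof (rule integral_mono_AE)
    show "AE s in unit_interval. t * \<psi> (\<bar>s\<bar> / r) \<le> 3 * (1 - exp (- (t * \<psi> (\<bar>s\<bar> / r))))"
      using AE_unit_interval
    proof eventually_elim
      case (elim s)
      let ?x = "t * \<psi> (\<bar>s\<bar> / r)"
      have "?x \<le> t * (2 * levy_h \<eta> \<nu> r)"
        using exponent_bounds(2)[OF rep r, of "\<bar>s\<bar>"] elim t_nonneg by (intro mult_left_mono) auto
      then have x: "0 \<le> ?x" "?x \<le> 2"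
        using exponent_bounds(1)[OF rep r, of "\<bar>s\<bar>"] elim t_nonneg h by auto
      \<comment> \<open>On [0,2] one has 1/(1+x) <= 1 - x/3, as this amounts to x^2 <= 2x. The
        restriction to [0,2] is where t h(r) <= 1 is used.\<close>
      have "exp (- ?x) \<le> 1 / (1 + ?x)"
        using exp_ge_add_one_self[of ?x] x by (simp add: exp_minus field_simps)
      also have "\<dots> \<le> 1 - ?x / 3"
      proof -
        have "?x * ?x \<le> 2 * ?x" using x by (intro mult_right_mono)
        then have "1 \<le> (1 - ?x / 3) * (1 + ?x)" by (simp add: algebra_simps)
        then show ?thesis using x by (simp add: divide_le_eq)
      qed
      finally show ?case by simp
    qed
  qed (intro integrable_mult_right integrable_exponent_unit_interval[OF r])+
  also have "\<dots> = 3 * (LINT y|\<mu>. LINT s|unit_interval. 1 - cos (s * (e \<bullet> y / r)))"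
    unfolding average_cos(1)[OF r e] by (rule integral_mult_right_zero)
  also have "(LINT y|\<mu>. LINT s|unit_interval. 1 - cos (s * (e \<bullet> y / r))) \<le> (LINT y|\<mu>. 2 * min 1 ((norm y)\<^sup>2 / r\<^sup>2))"
  proof (rule integral_mono[OF average_cos(2)[OF r e]])
    fix y :: 'v
    have le: "\<bar>e \<bullet> y / r\<bar> \<le> \<bar>norm y / r\<bar>"
      using Cauchy_Schwarz_ineq2[of e y] e r by (simp add: divide_right_mono)
    have "AE s in unit_interval. 1 - cos (s * (e \<bullet> y / r)) \<le> 2 * min 1 ((norm y / r)\<^sup>2)"
      using AE_unit_interval
    proof eventually_elim
      case (elim s)
      then show ?case using one_minus_cos_scaled_le[OF _ _ le, of s] by blast
    qed
    then have "(LINT s|unit_interval. 1 - cos (s * (e \<bullet> y / r))) \<le> (LINT s|unit_interval. 2 * min 1 ((norm y / r)\<^sup>2))"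
    proof (intro integral_mono_AE)
      have "norm (1 - cos x) \<le> 2" for x :: real
        using cos_ge_minus_one[of x] cos_le_one[of x] by auto
      then show "integrable unit_interval (\<lambda>s. 1 - cos (s * (e \<bullet> y / r)))"
        by (intro U.integrable_const_bound[of _ 2]) auto
    qed auto
    then show "(LINT s|unit_interval. 1 - cos (s * (e \<bullet> y / r))) \<le> 2 * min 1 ((norm y)\<^sup>2 / r\<^sup>2)"
      using U.prob_space by (simp add: power_divide)
  qed (use integrable_truncated in simp)
  also have "\<dots> = 2 * (LINT y|\<mu>. min 1 ((norm y)\<^sup>2 / r\<^sup>2))" by simp
  finally have *: "t * (LINT s|unit_interval. \<psi> (\<bar>s\<bar> / r)) \<le> 6 * (LINT y|\<mu>. min 1 ((norm y)\<^sup>2 / r\<^sup>2))"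
    by simp
  have "t * levy_h \<eta> \<nu> r \<le> t * (8 * real DIM('v) * (LINT s|unit_interval. \<psi> (\<bar>s\<bar> / r)))"
    using levy_h_le_average[OF rep r] t_nonneg by (intro mult_left_mono)
  also have "\<dots> = 8 * real DIM('v) * (t * (LINT s|unit_interval. \<psi> (\<bar>s\<bar> / r)))" by simp
  also have "\<dots> \<le> 8 * real DIM('v) * (6 * (LINT y|\<mu>. min 1 ((norm y)\<^sup>2 / r\<^sup>2)))"
    using * by (intro mult_left_mono) auto
  finally show ?thesis by simp
qed

text \<open>Here 1 - exp(-x) <= x is enough, which holds for every x, so no smallness of t h(r) is
  required. Applied at a fixed radius it shows that the mass outside a ball is O(t).\<close>

lemma truncated_moment_le:
  assumes r: "0 < r"
  shows "(LINT y|\<mu>. min 1 ((norm y)\<^sup>2 / r\<^sup>2)) \<le> 16 * real DIM('v) * (t * levy_h \<eta> \<nu> r)"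
proof -
  interpret U: prob_space unit_interval by (rule prob_space_unit_interval)
  let ?k = "\<lambda>b y. LINT s|unit_interval. 1 - cos (s * (b \<bullet> y / r))"
  have ik: "integrable \<mu> (?k b)" if "b \<in> Basis" for b
    using average_cos(2)[OF r, of b] that by simp
  have "min 1 ((norm y)\<^sup>2 / r\<^sup>2) \<le> 8 * (\<Sum>b\<in>Basis. ?k b y)" for y :: 'v
    by (rule truncated_square_le_sum_average)
  then have "(LINT y|\<mu>. min 1 ((norm y)\<^sup>2 / r\<^sup>2)) \<le> (LINT y|\<mu>. 8 * (\<Sum>b\<in>Basis. ?k b y))"
    using ik integrable_truncated by (intro integral_mono) auto
  also have "\<dots> = 8 * (\<Sum>b\<in>Basis. LINT y|\<mu>. ?k b y)"
    using ik by (simp add: Bochner_Integration.integral_sum)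
  also have "\<dots> = 8 * (\<Sum>b\<in>(Basis :: 'v set). LINT s|unit_interval. 1 - exp (- (t * \<psi> (\<bar>s\<bar> / r))))"
    using average_cos(1)[OF r] by simp
  also have "\<dots> \<le> 8 * (\<Sum>b\<in>(Basis :: 'v set). t * (2 * levy_h \<eta> \<nu> r))"
  proof (intro mult_left_mono sum_mono)
    have "(LINT s|unit_interval. 1 - exp (- (t * \<psi> (\<bar>s\<bar> / r)))) \<le> (LINT s|unit_interval. t * (2 * levy_h \<eta> \<nu> r))"
    proof (rule integral_mono_AE)
      show "AE s in unit_interval. 1 - exp (- (t * \<psi> (\<bar>s\<bar> / r))) \<le> t * (2 * levy_h \<eta> \<nu> r)"
        using AE_unit_interval
      proof eventually_elim
        case (elim s)
        have "t * \<psi> (\<bar>s\<bar> / r) \<le> t * (2 * levy_h \<eta> \<nu> r)"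
          using exponent_bounds(2)[OF rep r, of "\<bar>s\<bar>"] elim t_nonneg by (intro mult_left_mono) auto
        then show ?case using exp_ge_add_one_self[of "- (t * \<psi> (\<bar>s\<bar> / r))"] by linarith
      qed
    qed (use integrable_exponent_unit_interval[OF r] in auto)
    then show "(LINT s|unit_interval. 1 - exp (- (t * \<psi> (\<bar>s\<bar> / r)))) \<le> t * (2 * levy_h \<eta> \<nu> r)"
      using U.prob_space by simp
  qed simp
  finally show ?thesis by (simp add: algebra_simps)
qed


section \<open>Integration over the scale r\<close>

lemma integral_truncated_le:
  fixes x a \<delta> :: real
  assumes "0 \<le> x" "0 < a" "a \<le> \<delta>"
  shows "(LINT r|lborel. indicator {a..\<delta>} r * min 1 (x\<^sup>2 / r\<^sup>2)) \<le> 4 * min x \<delta>"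
proof -
  \<comment> \<open>A single rational majorant for both regimes r <= x and r > x: there x + r is at
    most 2x, respectively 2r. Its antiderivative \<open>?G\<close> is explicit, and the integral
    comes out below 4 x \<delta> / (x + \<delta>).\<close>
  let ?g = "\<lambda>r. 4 * x\<^sup>2 / (x + r)\<^sup>2" and ?G = "\<lambda>r. - 4 * x\<^sup>2 / (x + r)"
  have G: "has_bochner_integral lborel (\<lambda>r. ?g r * indicator {a..\<delta>} r) (?G \<delta> - ?G a)"
  proof (rule has_bochner_integral_FTC_Icc_real)
    fix r assume "a \<le> r" "r \<le> \<delta>"
    then have "x + r \<noteq> 0" using assms by linarith
    then show "(?G has_real_derivative ?g r) (at r)" "isCont ?g r"
      by (auto intro!: derivative_eq_intros simp: power2_eq_square)
  qed (rule assms)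
  have le: "min 1 (x\<^sup>2 / r\<^sup>2) \<le> ?g r" if "a \<le> r" for r
  proof (cases "r \<le> x")
    case True
    have "(x + r)\<^sup>2 \<le> (2 * x)\<^sup>2" using True that assms by (intro power_mono) auto
    then have "1 \<le> ?g r" using that assms by (simp add: le_divide_eq power_mult_distrib)
    then show ?thesis by linarith
  next
    case False
    have "(x + r)\<^sup>2 \<le> (2 * r)\<^sup>2" using False that assms by (intro power_mono) auto
    then have "4 * x\<^sup>2 / (2 * r)\<^sup>2 \<le> ?g r" using that assms by (intro divide_left_mono) auto
    then show ?thesis by (simp add: power_mult_distrib)
  qed
  have "(LINT r|lborel. indicator {a..\<delta>} r * min 1 (x\<^sup>2 / r\<^sup>2)) \<le> (LINT r|lborel. ?g r * indicator {a..\<delta>} r)"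
  proof (rule integral_mono)
    show "integrable lborel (\<lambda>r. indicator {a..\<delta>} r * min 1 (x\<^sup>2 / r\<^sup>2))"
    proof (rule Bochner_Integration.integrable_bound)
      show "integrable lborel (indicator {a..\<delta>} :: real \<Rightarrow> real)"
        by (simp add: integrable_indicator_iff emeasure_lborel_Icc_eq)
    qed (auto simp: indicator_def intro!: AE_I2)
    show "indicator {a..\<delta>} r * min 1 (x\<^sup>2 / r\<^sup>2) \<le> ?g r * indicator {a..\<delta>} r" for r
      using le[of r] by (auto simp: indicator_def)
  qed (use G has_bochner_integral_iff in blast)
  also have "\<dots> = 4 * (x\<^sup>2 / (x + a) - x\<^sup>2 / (x + \<delta>))"
    using G by (simp add: has_bochner_integral_iff)
  also have "\<dots> \<le> 4 * (x - x\<^sup>2 / (x + \<delta>))"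
  proof -
    have "x\<^sup>2 \<le> x * (x + a)" using assms by (simp add: power2_eq_square algebra_simps)
    then have "x\<^sup>2 / (x + a) \<le> x" using assms by (simp add: divide_le_eq)
    then show ?thesis by simp
  qed
  also have "x - x\<^sup>2 / (x + \<delta>) = x * \<delta> / (x + \<delta>)"
    using assms by (simp add: field_simps power2_eq_square)
  also have "\<dots> \<le> min x \<delta>"
  proof -
    have "x * \<delta> \<le> x * (x + \<delta>)" "x * \<delta> \<le> \<delta> * (x + \<delta>)"
      using assms by (simp_all add: algebra_simps)
    then show ?thesis using assms by (simp add: divide_le_eq)
  qed
  finally show ?thesis by simp
qed

text \<open>Integrating the truncated square in r turns a second moment into a first one, min(|y|,
  \<delta>). The factor 192 is 48 * 4. The smallness of t h is assumed strictly above
  \<open>a\<close> only, which is what a supremum provides.\<close>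

lemma integral_levy_h_le:
  assumes a: "0 < a" "a \<le> \<delta>" and h: "\<And>r. a < r \<Longrightarrow> r \<le> \<delta> \<Longrightarrow> t * levy_h \<eta> \<nu> r \<le> 1"
  shows "t * (LINT r:{a..\<delta>}|lborel. levy_h \<eta> \<nu> r)
     \<le> 192 * real DIM('v) * ((LINT y|\<mu>. indicator {y. norm y < \<delta>} y * norm y)
          + 16 * real DIM('v) * \<delta> * (t * levy_h \<eta> \<nu> \<delta>))"
proof -
  have \<nu>: "levy_measure \<nu>" and \<eta>: "0 \<le> \<eta>" using rep by (auto simp: isotropic_levy_khintchine_def)
  have [measurable]: "levy_h \<eta> \<nu> \<in> borel_measurable borel" by (rule levy_h_measurable[OF \<nu>])
  interpret P: pair_sigma_finite lborel \<mu> ..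
  have iI: "integrable lborel (\<lambda>r. indicator {a..\<delta>} r * f r)"
    if "f \<in> borel_measurable borel" "\<And>r. a \<le> r \<Longrightarrow> r \<le> \<delta> \<Longrightarrow> norm (f r) \<le> B" for f :: "real \<Rightarrow> real" and B
  proof (rule Bochner_Integration.integrable_bound)
    show "integrable lborel (\<lambda>r. B * indicator {a..\<delta>} r :: real)"
      by (intro integrable_mult_right) (simp add: integrable_indicator_iff emeasure_lborel_Icc_eq)
  qed (use that in \<open>auto simp: indicator_def intro!: AE_I2 order_trans[OF _ abs_ge_self]\<close>)
  have prod: "integrable (lborel \<Otimes>\<^sub>M \<mu>) (\<lambda>(r, y). indicator {a..\<delta>} r * min 1 ((norm y)\<^sup>2 / r\<^sup>2))"
  proof (rule P.Fubini_integrable)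
    have "integrable lborel (\<lambda>r. indicator {a..\<delta>} r * (LINT y|\<mu>. min 1 ((norm y)\<^sup>2 / r\<^sup>2)))"
    proof (rule iI)
      show "norm (LINT y|\<mu>. min 1 ((norm y)\<^sup>2 / r\<^sup>2)) \<le> 1" for r
        using integral_mono[OF integrable_truncated[of r], of "\<lambda>_. 1"]
          Bochner_Integration.integral_nonneg[of \<mu> "\<lambda>y. min 1 ((norm y)\<^sup>2 / r\<^sup>2)"] by (auto simp: prob_space)
    qed measurable
    then show "integrable lborel (\<lambda>r. LINT y|\<mu>. norm (case (r, y) of (r, y) \<Rightarrow> indicator {a..\<delta>} r * min 1 ((norm y)\<^sup>2 / r\<^sup>2)))"
      by (simp add: abs_mult)
  qed (use integrable_truncated in auto)
  have ir: "integrable \<mu> (\<lambda>y. indicator {y. norm y < \<delta>} y * norm y)"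
    by (rule integrable_const_bound[of _ \<delta>]) (use a in \<open>auto simp: indicator_def intro!: AE_I2\<close>)
  have "t * (LINT r:{a..\<delta>}|lborel. levy_h \<eta> \<nu> r) = (LINT r|lborel. indicator {a..\<delta>} r * (t * levy_h \<eta> \<nu> r))"
    unfolding set_lebesgue_integral_def by (subst integral_mult_right_zero[symmetric]) (simp add: ac_simps)
  also have "\<dots> \<le> (LINT r|lborel. 48 * real DIM('v) * (LINT y|\<mu>. indicator {a..\<delta>} r * min 1 ((norm y)\<^sup>2 / r\<^sup>2)))"
  proof (rule integral_mono_AE)
    show "integrable lborel (\<lambda>r. indicator {a..\<delta>} r * (t * levy_h \<eta> \<nu> r))"
    proof (rule iI)
      fix r assume "a \<le> r" "r \<le> \<delta>"
      then have "t * levy_h \<eta> \<nu> r \<le> t * levy_h \<eta> \<nu> a"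
        using levy_h_antimono[OF \<nu> \<eta>, of a r] a t_nonneg by (intro mult_left_mono) auto
      then show "norm (t * levy_h \<eta> \<nu> r) \<le> t * levy_h \<eta> \<nu> a"
        using levy_h_nonneg[OF \<eta>, of \<nu> r] t_nonneg by (simp add: abs_mult)
    qed measurable
    show "integrable lborel (\<lambda>r. 48 * real DIM('v) * (LINT y|\<mu>. indicator {a..\<delta>} r * min 1 ((norm y)\<^sup>2 / r\<^sup>2)))"
      using P.integrable_fst[OF prod] by simp
    \<comment> \<open>At the endpoint r = a nothing is known about t h(r); this point is
      null.\<close>
    show "AE r in lborel. indicator {a..\<delta>} r * (t * levy_h \<eta> \<nu> r)
        \<le> 48 * real DIM('v) * (LINT y|\<mu>. indicator {a..\<delta>} r * min 1 ((norm y)\<^sup>2 / r\<^sup>2))"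
      using AE_lborel_singleton[of a]
    proof eventually_elim
      case (elim r)
      then show ?case using truncated_moment_ge[of r] h[of r] a by (auto simp: indicator_def)
    qed
  qed
  also have "\<dots> = 48 * real DIM('v) * (LINT y|\<mu>. LINT r|lborel. indicator {a..\<delta>} r * min 1 ((norm y)\<^sup>2 / r\<^sup>2))"
    using P.Fubini_integral[OF prod] by simp
  also have "\<dots> \<le> 48 * real DIM('v) *
      (LINT y|\<mu>. 4 * (indicator {y. norm y < \<delta>} y * norm y + \<delta> * min 1 ((norm y)\<^sup>2 / \<delta>\<^sup>2)))"
  proof (intro mult_left_mono integral_mono)
    show "integrable \<mu> (\<lambda>y. LINT r|lborel. indicator {a..\<delta>} r * min 1 ((norm y)\<^sup>2 / r\<^sup>2))"
      using P.integrable_snd[OF prod] by simp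
    show "(LINT r|lborel. indicator {a..\<delta>} r * min 1 ((norm y)\<^sup>2 / r\<^sup>2))
        \<le> 4 * (indicator {y. norm y < \<delta>} y * norm y + \<delta> * min 1 ((norm y)\<^sup>2 / \<delta>\<^sup>2))" for y
    proof -
      \<comment> \<open>Outside the ball the truncated square equals 1, so the second summand pays
        for \<delta> there and becomes the O(t) term.\<close>
      have "min (norm y) \<delta> \<le> indicator {y. norm y < \<delta>} y * norm y + \<delta> * min 1 ((norm y)\<^sup>2 / \<delta>\<^sup>2)"
      proof (cases "norm y < \<delta>")
        case True
        then show ?thesis using a by simp
      next
        case False
        then have "\<delta>\<^sup>2 \<le> (norm y)\<^sup>2" using a by (intro power_mono) auto
        then have "1 \<le> (norm y)\<^sup>2 / \<delta>\<^sup>2" using a by simp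
        then show ?thesis using False by simp
      qed
      then show ?thesis using integral_truncated_le[of "norm y" a \<delta>] a by simp
    qed
  qed (use ir integrable_truncated in auto)
  also have "\<dots> = 192 * real DIM('v) * ((LINT y|\<mu>. indicator {y. norm y < \<delta>} y * norm y)
      + \<delta> * (LINT y|\<mu>. min 1 ((norm y)\<^sup>2 / \<delta>\<^sup>2)))"
    using ir integrable_truncated by simp
  also have "\<dots> \<le> 192 * real DIM('v) * ((LINT y|\<mu>. indicator {y. norm y < \<delta>} y * norm y)
      + \<delta> * (16 * real DIM('v) * (t * levy_h \<eta> \<nu> \<delta>)))"
    using truncated_moment_le[of \<delta>] a by (intro mult_left_mono add_left_mono) auto
  finally show ?thesis by (simp add: algebra_simps)
qed

end

section \<open>Perimeter and the first moment\<close>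

lemma orthogonal_transformation_reflection:
  fixes v :: "'v::euclidean_space"
  assumes "v \<noteq> 0"
  shows "orthogonal_transformation (\<lambda>y. y - (2 * (y \<bullet> v) / (v \<bullet> v)) *\<^sub>R v)"
  unfolding orthogonal_transformation_def
proof (intro conjI allI)
  show "linear (\<lambda>y. y - (2 * (y \<bullet> v) / (v \<bullet> v)) *\<^sub>R v)"
    by (rule linearI) (auto simp: inner_add_left algebra_simps add_divide_distrib)
  have nz: "v \<bullet> v \<noteq> 0" using assms by simp
  show "(x - (2 * (x \<bullet> v) / (v \<bullet> v)) *\<^sub>R v) \<bullet> (y - (2 * (y \<bullet> v) / (v \<bullet> v)) *\<^sub>R v) = x \<bullet> y" for x y
  proof -
    define c p q where "c = v \<bullet> v" and "p = x \<bullet> v" and "q = y \<bullet> v"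
    have "(x - (2 * p / c) *\<^sub>R v) \<bullet> (y - (2 * q / c) *\<^sub>R v)
        = x \<bullet> y - (2 * q / c) * p - (2 * p / c) * q + (2 * p / c) * ((2 * q / c) * c)"
      unfolding inner_diff_left inner_diff_right inner_scaleR_left inner_scaleR_right inner_commute[of v y]
        c_def[symmetric] p_def[symmetric] q_def[symmetric] by (simp add: algebra_simps)
    also have "\<dots> = x \<bullet> y"
      using nz by (simp add: c_def[symmetric])
    finally show ?thesis by (simp add: c_def p_def q_def)
  qed
qed

lemma rotation_invariant_integral:
  fixes \<mu> :: "'v::euclidean_space measure" and f :: "'v \<Rightarrow> real"
  assumes "rotation_invariant \<mu>" "sets \<mu> = sets borel" "orthogonal_transformation T" "f \<in> borel_measurable borel"
  shows "(LINT y|\<mu>. f (T y)) = (LINT y|\<mu>. f y)"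
proof -
  have "T \<in> borel_measurable borel"
    using assms(3) by (intro borel_measurable_continuous_onI linear_continuous_on)
      (simp add: orthogonal_transformation_def linear_conv_bounded_linear)
  then have "T \<in> borel_measurable \<mu>" using measurable_cong_sets[OF assms(2) refl] by blast
  then have "(LINT y|distr \<mu> borel T. f y) = (LINT y|\<mu>. f (T y))"
    using assms(4) by (rule integral_distr)
  then show ?thesis using assms(1,3) by (simp add: rotation_invariant_def)
qed

text \<open>Two kinds of reflection suffice to see that the moment matrix is scalar: the one along i
  kills the off-diagonal entries, the one along i - k equates diagonal entries. The weight 1/|y|
  makes the trace the truncated first moment.\<close>

lemma truncated_quadratic_moment:
  fixes \<mu> :: "'v::euclidean_space measure" and \<delta> :: real
  defines "w \<equiv> \<lambda>y::'v. indicator {y. norm y < \<delta>} y / norm y :: real"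
  assumes inv: "rotation_invariant \<mu>" and sets: "sets \<mu> = sets borel" and fin: "finite_measure \<mu>"
    and \<delta>: "0 < \<delta>" and i: "i \<in> Basis" and j: "j \<in> Basis"
  shows "integrable \<mu> (\<lambda>y. w y * ((y \<bullet> i) * (y \<bullet> j)))"
    and "(LINT y|\<mu>. w y * ((y \<bullet> i) * (y \<bullet> j)))
      = (if i = j then (LINT y|\<mu>. indicator {y. norm y < \<delta>} y * norm y) / real DIM('v) else 0)"
proof -
  interpret finite_measure \<mu> by (rule fin)
  note [measurable_cong] = sets
  have [measurable]: "w \<in> borel_measurable borel" unfolding w_def by measurable
  have int: "integrable \<mu> (\<lambda>y. w y * ((y \<bullet> k) * (y \<bullet> l)))" if kl: "k \<in> Basis" "l \<in> Basis" for k l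
  proof (rule integrable_const_bound[of _ \<delta>])
    have "norm (w y * ((y \<bullet> k) * (y \<bullet> l))) \<le> \<delta>" for y
    \<comment> \<open>Division by zero gives \<open>w 0 = 0\<close>, so the origin needs no
      exception in the statement.\<close>
    proof (cases "norm y < \<delta> \<and> y \<noteq> 0")
      case True
      have "\<bar>y \<bullet> k\<bar> * \<bar>y \<bullet> l\<bar> \<le> norm y * norm y"
        using Basis_le_norm[OF kl(1), of y] Basis_le_norm[OF kl(2), of y] by (intro mult_mono) auto
      then have "\<bar>y \<bullet> k\<bar> * \<bar>y \<bullet> l\<bar> / norm y \<le> norm y" using True by (simp add: divide_le_eq)
      then show ?thesis using True by (simp add: w_def abs_mult)
    next
      case False
      then show ?thesis using \<delta> by (auto simp: w_def)
    qed
    then show "AE y in \<mu>. norm (w y * ((y \<bullet> k) * (y \<bullet> l))) \<le> \<delta>" by simp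
  qed measurable
  show "integrable \<mu> (\<lambda>y. w y * ((y \<bullet> i) * (y \<bullet> j)))" by (rule int[OF i j])
  have w_norm: "w x = w y" if "norm x = norm y" for x y using that by (simp add: w_def indicator_def)
  have off: "(LINT y|\<mu>. w y * ((y \<bullet> i) * (y \<bullet> j))) = 0" if "i \<noteq> j"
  proof -
    \<comment> \<open>This reflection changes the sign of the coordinate along i and keeps all
      others, so the integral equals its negative.\<close>
    let ?T = "\<lambda>y. y - (2 * (y \<bullet> i) / (i \<bullet> i)) *\<^sub>R i"
    have T: "orthogonal_transformation ?T"
      using i nonzero_Basis by (intro orthogonal_transformation_reflection) auto
    have wT: "w (?T y) = w y" for y
      by (rule w_norm) (rule orthogonal_transformation_norm[OF T])
    have "(LINT y|\<mu>. w y * ((y \<bullet> i) * (y \<bullet> j))) = (LINT y|\<mu>. w (?T y) * ((?T y \<bullet> i) * (?T y \<bullet> j)))"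
      by (rule rotation_invariant_integral[OF inv sets T, symmetric]) measurable
    also have "\<dots> = (LINT y|\<mu>. - (w y * ((y \<bullet> i) * (y \<bullet> j))))"
      unfolding wT using i j that by (simp add: inner_diff_left inner_Basis)
    finally show ?thesis by simp
  qed
  have diag: "(LINT y|\<mu>. w y * ((y \<bullet> i) * (y \<bullet> i))) = (LINT y|\<mu>. w y * ((y \<bullet> k) * (y \<bullet> k)))"
    if k: "k \<in> Basis" for k
  proof (cases "i = k")
    case False
    \<comment> \<open>Reflecting along i - k exchanges the coordinates along i and k.\<close>
    let ?v = "i - k"
    let ?T = "\<lambda>y. y - (2 * (y \<bullet> ?v) / (?v \<bullet> ?v)) *\<^sub>R ?v"
    have T: "orthogonal_transformation ?T"
      using False by (intro orthogonal_transformation_reflection) auto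
    have v: "?v \<bullet> ?v = 2"
      using False i k by (simp add: inner_diff_left inner_diff_right inner_Basis)
    have Ti: "?T y \<bullet> i = y \<bullet> k" for y
    proof -
      have "?T y = y - (y \<bullet> i - y \<bullet> k) *\<^sub>R (i - k)" unfolding v by (simp add: inner_diff_right)
      then show ?thesis using False i k by (simp add: inner_diff_left inner_Basis)
    qed
    have wT: "w (?T y) = w y" for y
      by (rule w_norm) (rule orthogonal_transformation_norm[OF T])
    have "(LINT y|\<mu>. w y * ((y \<bullet> i) * (y \<bullet> i))) = (LINT y|\<mu>. w (?T y) * ((?T y \<bullet> i) * (?T y \<bullet> i)))"
      by (rule rotation_invariant_integral[OF inv sets T, symmetric]) measurable
    then show ?thesis unfolding wT Ti .
  qed simp
  have "(LINT y|\<mu>. indicator {y. norm y < \<delta>} y * norm y) = (LINT y|\<mu>. (\<Sum>k\<in>Basis. w y * ((y \<bullet> k) * (y \<bullet> k))))"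
  proof (rule Bochner_Integration.integral_cong[OF refl])
    fix y
    have "(\<Sum>k\<in>Basis. w y * ((y \<bullet> k) * (y \<bullet> k))) = w y * (norm y)\<^sup>2"
      unfolding power2_norm_eq_inner sum_distrib_left[symmetric] by (subst (3) euclidean_inner) simp
    also have "\<dots> = indicator {y. norm y < \<delta>} y * norm y"
      by (simp add: w_def power2_eq_square)
    finally show "indicator {y. norm y < \<delta>} y * norm y = (\<Sum>k\<in>Basis. w y * ((y \<bullet> k) * (y \<bullet> k)))" by simp
  qed
  also have "\<dots> = (\<Sum>k\<in>Basis. LINT y|\<mu>. w y * ((y \<bullet> k) * (y \<bullet> k)))"
    using int by (intro Bochner_Integration.integral_sum) auto
  also have "\<dots> = (\<Sum>k\<in>(Basis :: 'v set). LINT y|\<mu>. w y * ((y \<bullet> i) * (y \<bullet> i)))"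
    by (intro sum.cong refl diag[symmetric])
  also have "\<dots> = real DIM('v) * (LINT y|\<mu>. w y * ((y \<bullet> i) * (y \<bullet> i)))"
    by simp
  finally have "(LINT y|\<mu>. w y * ((y \<bullet> i) * (y \<bullet> i)))
      = (LINT y|\<mu>. indicator {y. norm y < \<delta>} y * norm y) / real DIM('v)" by simp
  then show "(LINT y|\<mu>. w y * ((y \<bullet> i) * (y \<bullet> j)))
      = (if i = j then (LINT y|\<mu>. indicator {y. norm y < \<delta>} y * norm y) / real DIM('v) else 0)"
    using off by auto
qed

text \<open>The function D of the overview. For finite volume it is the drop of the covariogram of
  \<Omega>: the volume of \<Omega> minus that of its intersection with \<Omega> - y.\<close>

definition escape :: "'v::euclidean_space set \<Rightarrow> 'v \<Rightarrow> real" where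
  "escape \<Omega> y = measure lborel {x\<in>\<Omega>. x + y \<notin> \<Omega>}"

lemma escape_eq_integral:
  assumes [measurable]: "\<Omega> \<in> sets borel"
  shows "escape \<Omega> y = (LINT x|lborel. indicator \<Omega> x * indicator (- \<Omega>) (x + y))"
proof -
  have [measurable]: "- \<Omega> \<in> sets borel" using assms by (simp add: borel_comp)
  have "(LINT x|lborel. indicator \<Omega> x * indicator (- \<Omega>) (x + y) :: real) = (LINT x|lborel. indicator {x\<in>\<Omega>. x + y \<notin> \<Omega>} x :: real)"
    by (intro Bochner_Integration.integral_cong) (auto simp: indicator_def)
  then show ?thesis by (simp add: escape_def)
qed

lemma escape_bounds:
  assumes [measurable]: "\<Omega> \<in> sets borel" and "emeasure lborel \<Omega> < \<infinity>"
  shows "0 \<le> escape \<Omega> y" "escape \<Omega> y \<le> measure lborel \<Omega>"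
  unfolding escape_def using assms by (auto intro!: measure_mono_fmeasurable simp: fmeasurable_def)

lemma escape_measurable:
  assumes [measurable]: "\<Omega> \<in> sets borel"
  shows "escape \<Omega> \<in> borel_measurable borel"
proof -
  have [measurable]: "- \<Omega> \<in> sets borel" using assms by (simp add: borel_comp)
  have "escape \<Omega> = (\<lambda>y. LINT x|lborel. indicator \<Omega> x * indicator (- \<Omega>) (x + y))"
    using escape_eq_integral[OF assms] by (intro ext)
  also have "\<dots> \<in> borel_measurable borel"
    by measurable
  finally show ?thesis .
qed

section \<open>Translations of Lebesgue measure and increments along a shift\<close>

lemma integral_lborel_shift:
  fixes f :: "'v::euclidean_space \<Rightarrow> real"
  assumes "f \<in> borel_measurable borel"
  shows "(LINT x|lborel. f (x + y)) = (LINT x|lborel. f x)"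
proof -
  have "(LINT x|distr lborel borel ((+) y). f x) = (LINT x|lborel. f (y + x))"
    using assms by (intro integral_distr) auto
  then show ?thesis by (simp add: lborel_distr_plus add.commute)
qed

lemma integrable_lborel_shift:
  fixes f :: "'v::euclidean_space \<Rightarrow> real"
  assumes "integrable lborel f"
  shows "integrable lborel (\<lambda>x. f (x + y))"
proof -
  have "integrable (distr lborel borel ((+) y)) f" using assms by (simp add: lborel_distr_plus)
  then have "integrable lborel (\<lambda>x. f (y + x))" by (rule integrable_distr[rotated]) simp
  then show ?thesis by (simp add: add.commute)
qed

text \<open>A change of variables moves the shift from f to the indicator. What remains is f
  integrated against the difference of the indicators of \<Omega> + y and \<Omega>, hence at most
  the volume of their symmetric difference; its two halves have equal volume, whence the factor
  2.\<close>

lemma integral_increment_le_escape: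
  fixes \<Omega> :: "'v::euclidean_space set" and f :: "'v \<Rightarrow> real"
  assumes \<Omega> [measurable]: "\<Omega> \<in> sets borel" and fin: "emeasure lborel \<Omega> < \<infinity>"
    and [measurable]: "f \<in> borel_measurable borel" and f: "\<And>x. \<bar>f x\<bar> \<le> 1"
  shows "(LINT x|lborel. indicator \<Omega> x * (f (x + y) - f x)) \<le> 2 * escape \<Omega> y"
proof -
  have i\<Omega>: "integrable lborel (indicator \<Omega> :: 'v \<Rightarrow> real)" using fin by simp
  have bd: "integrable lborel (\<lambda>x. indicator \<Omega> x * g x)" if "g \<in> borel_measurable borel" "\<And>x. \<bar>g x\<bar> \<le> 1" for g :: "'v \<Rightarrow> real"
    by (rule Bochner_Integration.integrable_bound[OF i\<Omega>])
      (use that in \<open>auto simp: abs_mult intro!: AE_I2 mult_left_le\<close>)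
  let ?a = "\<lambda>x. indicator \<Omega> x :: real" and ?b = "\<lambda>x. indicator \<Omega> (x - y) :: real"
  have shift: "integrable lborel (\<lambda>x. ?b x * g x)" "(LINT x|lborel. indicator \<Omega> x * g (x + y)) = (LINT x|lborel. ?b x * g x)"
    if [measurable]: "g \<in> borel_measurable borel" and "\<And>x. \<bar>g x\<bar> \<le> 1" for g
  proof -
    have "integrable lborel (\<lambda>x. indicator \<Omega> x * g (x + y))" using that(2) by (intro bd) auto
    from integrable_lborel_shift[OF this, of "-y"] show "integrable lborel (\<lambda>x. ?b x * g x)" by simp
    show "(LINT x|lborel. indicator \<Omega> x * g (x + y)) = (LINT x|lborel. ?b x * g x)"
      using integral_lborel_shift[of "\<lambda>x. indicator \<Omega> x * g (x + y)" "-y"] by simp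
  qed
  have sb: "(LINT x|lborel. ?b x) = (LINT x|lborel. ?a x)"
    using integral_lborel_shift[of ?a "-y"] by simp
  have ib: "integrable lborel ?b" using shift(1)[of "\<lambda>_. 1"] by simp
  have iab: "integrable lborel (\<lambda>x. ?b x * ?a x)" by (intro shift(1)) auto
  have esc: "escape \<Omega> y = (LINT x|lborel. ?a x) - (LINT x|lborel. ?b x * ?a x)"
  proof -
    have "escape \<Omega> y = (LINT x|lborel. ?a x - ?a x * indicator \<Omega> (x + y))"
      unfolding escape_eq_integral[OF \<Omega>]
      by (intro Bochner_Integration.integral_cong) (auto simp: indicator_def)
    also have "\<dots> = (LINT x|lborel. ?a x) - (LINT x|lborel. ?a x * indicator \<Omega> (x + y))"
      by (intro Bochner_Integration.integral_diff i\<Omega> bd) auto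
    finally show ?thesis using shift(2)[of ?a] by simp
  qed
  have "(LINT x|lborel. indicator \<Omega> x * (f (x + y) - f x)) = (LINT x|lborel. ?a x * f (x + y)) - (LINT x|lborel. ?a x * f x)"
    unfolding right_diff_distrib using f by (intro Bochner_Integration.integral_diff bd) auto
  also have "\<dots> = (LINT x|lborel. ?b x * f x - ?a x * f x)"
    using f by (simp add: shift bd)
  \<comment> \<open>The combination a + b - 2ab is the indicator of the symmetric
    difference.\<close>
  also have "\<dots> \<le> (LINT x|lborel. ?a x + ?b x - 2 * (?b x * ?a x))"
  proof (rule integral_mono)
    show "integrable lborel (\<lambda>x. ?b x * f x - ?a x * f x)" using f by (intro Bochner_Integration.integrable_diff shift bd) auto
    show "integrable lborel (\<lambda>x. ?a x + ?b x - 2 * (?b x * ?a x))" using i\<Omega> ib iab by auto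
    show "?b x * f x - ?a x * f x \<le> ?a x + ?b x - 2 * (?b x * ?a x)" for x
      using f[of x] by (auto simp: indicator_def)
  qed
  also have "\<dots> = 2 * escape \<Omega> y"
    unfolding esc using i\<Omega> ib iab sb by simp
  finally show ?thesis .
qed

section \<open>Test fields: uniform continuity, divergence and quadratic forms\<close>

lemma uniformly_continuous_on_compact_support:
  fixes f :: "'v::euclidean_space \<Rightarrow> 'b::real_normed_vector"
  assumes cont: "continuous_on UNIV f" and K: "compact K" and zero: "\<And>x. x \<notin> K \<Longrightarrow> f x = 0"
  shows "uniformly_continuous_on UNIV f"
  unfolding uniformly_continuous_on_def
proof (intro allI impI)
  fix e :: real assume e: "0 < e"
  \<comment> \<open>K thickened by the unit ball: two points closer than 1, one of them in K, both
    lie in the compact set L; if neither lies in K, both values are 0.\<close>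
  define L where "L = (\<lambda>(x, y). x + y) ` (K \<times> cball 0 1)"
  have "compact L"
    unfolding L_def by (intro compact_continuous_image compact_Times K compact_cball) (auto simp: case_prod_beta intro!: continuous_intros)
  then have "uniformly_continuous_on L f"
    using cont by (intro compact_uniformly_continuous) (auto intro: continuous_on_subset)
  then obtain d where d: "0 < d" "\<And>x x'. x \<in> L \<Longrightarrow> x' \<in> L \<Longrightarrow> dist x' x < d \<Longrightarrow> dist (f x') (f x) < e"
    using e unfolding uniformly_continuous_on_def by metis
  have near: "x' \<in> L" if "x \<in> K" "dist x' x < 1" for x x'
    unfolding L_def using that by (intro image_eqI[of _ _ "(x, x' - x)"]) (auto simp: dist_norm norm_minus_commute)
  have "dist (f x') (f x) < e" if "dist x' x < min d 1" for x x'
  proof (cases "x \<in> K \<or> x' \<in> K")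
    case True
    then have "x \<in> L" "x' \<in> L" using near[of x x] near[of x' x'] near[of x x'] near[of x' x] that by (auto simp: dist_commute)
    then show ?thesis using d(2) that by auto
  next
    case False
    then show ?thesis using zero e by simp
  qed
  then show "\<exists>d>0. \<forall>x\<in>UNIV. \<forall>x'\<in>UNIV. dist x' x < d \<longrightarrow> dist (f x') (f x) < e"
    using d(1) by (intro exI[of _ "min d 1"]) auto
qed

lemma derivative_zero_off_support:
  fixes \<phi> :: "'v::euclidean_space \<Rightarrow> 'v"
  assumes "\<And>x. (\<phi> has_derivative blinfun_apply (\<phi>' x)) (at x)" and x: "x \<notin> closure {x. \<phi> x \<noteq> 0}"
  shows "\<phi>' x = 0"
proof -
  have "((\<lambda>x. 0) has_derivative blinfun_apply (\<phi>' x)) (at x)"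
  proof (rule has_derivative_transform_within_open[OF assms(1)])
    show "open (- closure {x. \<phi> x \<noteq> 0})" by (intro open_Compl closed_closure)
    show "\<phi> y = 0" if "y \<in> - closure {x. \<phi> x \<noteq> 0}" for y
      using that closure_subset[of "{x. \<phi> x \<noteq> 0}"] by auto
  qed (use x in auto)
  then have "blinfun_apply (\<phi>' x) = (\<lambda>_. 0)"
    by (rule has_derivative_unique) (rule has_derivative_const)
  then show ?thesis by (intro blinfun_eqI) simp
qed

lemma divergence_eq:
  fixes \<phi> :: "'v::euclidean_space \<Rightarrow> 'v"
  assumes "(\<phi> has_derivative blinfun_apply A) (at x)"
  shows "divergence \<phi> x = (\<Sum>b\<in>Basis. blinfun_apply A b \<bullet> b)"
  using frechet_derivative_at[OF assms] by (simp add: divergence_def)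

text \<open>Separates y from the matrix entries, so that integrating over x leaves constants and
  averaging over y meets only the moments of the law.\<close>

lemma blinfun_quadratic_form:
  fixes A :: "'v::euclidean_space \<Rightarrow>\<^sub>L 'v"
  shows "blinfun_apply A y \<bullet> y = (\<Sum>i\<in>Basis. \<Sum>j\<in>Basis. ((y \<bullet> i) * (y \<bullet> j)) * (blinfun_apply A i \<bullet> j))"
proof -
  have "blinfun_apply A y = (\<Sum>i\<in>Basis. (y \<bullet> i) *\<^sub>R blinfun_apply A i)"
    by (subst (1) euclidean_representation[of y, symmetric]) (simp add: blinfun.sum_right blinfun.scaleR_right)
  then have "blinfun_apply A y \<bullet> y = (\<Sum>i\<in>Basis. (y \<bullet> i) * (blinfun_apply A i \<bullet> y))"
    by (simp add: inner_sum_left)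
  also have "\<dots> = (\<Sum>i\<in>Basis. \<Sum>j\<in>Basis. ((y \<bullet> i) * (y \<bullet> j)) * (blinfun_apply A i \<bullet> j))"
    by (subst euclidean_inner[of _ y]) (simp add: sum_distrib_left ac_simps)
  finally show ?thesis .
qed

text \<open>The order of quantifiers is the point: \<delta>0 comes from the uniform continuity of
  the derivative of \<phi> alone, before the law is given, so that one radius serves all times. The
  term with \<epsilon> is the error of linearising \<phi>.\<close>

lemma escape_average_ge:
  fixes \<Omega> :: "'v::euclidean_space set" and \<phi> :: "'v \<Rightarrow> 'v"
  assumes \<Omega>: "\<Omega> \<in> sets borel" and fin: "emeasure lborel \<Omega> < \<infinity>"
    and C1: "C1 \<phi>" and supp: "compact (closure {x. \<phi> x \<noteq> 0})" and bd: "\<And>x. norm (\<phi> x) \<le> 1"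
    and \<epsilon>: "0 < \<epsilon>"
  obtains \<delta>0 where "0 < \<delta>0"
    "\<And>\<mu> \<delta>. prob_space \<mu> \<Longrightarrow> sets \<mu> = sets borel \<Longrightarrow> rotation_invariant \<mu> \<Longrightarrow> 0 < \<delta> \<Longrightarrow> \<delta> \<le> \<delta>0 \<Longrightarrow>
       ((LINT x|lborel. indicator \<Omega> x * divergence \<phi> x) / real DIM('v) - \<epsilon> * measure lborel \<Omega>)
         * (LINT y|\<mu>. indicator {y. norm y < \<delta>} y * norm y) \<le> 2 * (LINT y|\<mu>. escape \<Omega> y)"
proof -
  note [measurable] = \<Omega>
  have i\<Omega>: "integrable lborel (indicator \<Omega> :: 'v \<Rightarrow> real)" using \<Omega> fin by simp
  have m\<Omega>: "(LINT x|lborel. indicator \<Omega> x) = measure lborel \<Omega>" by simp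
  obtain \<phi>' where der: "\<And>x. (\<phi> has_derivative blinfun_apply (\<phi>' x)) (at x)" and cont: "continuous_on UNIV \<phi>'"
    using C1 unfolding C1_def by blast
  let ?K = "closure {x. \<phi> x \<noteq> 0}"
  have zero: "\<phi>' x = 0" if "x \<notin> ?K" for x using derivative_zero_off_support[OF der that] .
  have "uniformly_continuous_on UNIV \<phi>'"
    by (rule uniformly_continuous_on_compact_support[OF cont supp zero])
  then obtain \<delta>0 where \<delta>0: "0 < \<delta>0" "\<And>x x'. dist x' x < \<delta>0 \<Longrightarrow> dist (\<phi>' x') (\<phi>' x) < \<epsilon>"
    using \<epsilon> unfolding uniformly_continuous_on_def by (metis UNIV_I)
  have "bounded (\<phi>' ` ?K)"
    using cont supp by (intro compact_imp_bounded compact_continuous_image) (auto intro: continuous_on_subset)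
  then obtain B where B: "\<And>x. x \<in> ?K \<Longrightarrow> norm (\<phi>' x) \<le> B" "0 < B"
    unfolding bounded_pos by auto
  have B': "norm (\<phi>' x) \<le> B" for x using B zero[of x] by (cases "x \<in> ?K") auto
  have \<phi>_cont: "continuous_on UNIV \<phi>"
    using der by (meson has_derivative_continuous continuous_at_imp_continuous_on)
  have [measurable]: "\<phi> \<in> borel_measurable borel" by (rule borel_measurable_continuous_onI[OF \<phi>_cont])
  have m\<phi>' [measurable]: "(\<lambda>x. blinfun_apply (\<phi>' x) i \<bullet> j) \<in> borel_measurable borel" for i j
    by (intro borel_measurable_continuous_onI continuous_intros cont)
  have ia: "integrable lborel (\<lambda>x. indicator \<Omega> x * (blinfun_apply (\<phi>' x) i \<bullet> j))" if "i \<in> Basis" "j \<in> Basis" for i j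
  proof (rule Bochner_Integration.integrable_bound)
    show "integrable lborel (\<lambda>x. B * indicator \<Omega> x :: real)" using i\<Omega> by (rule integrable_mult_right)
    have "\<bar>blinfun_apply (\<phi>' x) i \<bullet> j\<bar> \<le> B" for x
    proof -
      have "\<bar>blinfun_apply (\<phi>' x) i \<bullet> j\<bar> \<le> norm (blinfun_apply (\<phi>' x) i) * norm j" by (rule Cauchy_Schwarz_ineq2)
      also have "\<dots> \<le> norm (\<phi>' x)" using norm_blinfun[of "\<phi>' x" i] that by simp
      finally show ?thesis using B'[of x] by linarith
    qed
    then show "AE x in lborel. norm (indicator \<Omega> x * (blinfun_apply (\<phi>' x) i \<bullet> j)) \<le> norm (B * indicator \<Omega> x :: real)"
      using B(2) by (intro AE_I2) (auto simp: indicator_def)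
  qed measurable
  \<comment> \<open>The integral of the derivative matrix of \<phi> over \<Omega>; its trace is the
    integral of the divergence.\<close>
  define a where "a i j = (LINT x|lborel. indicator \<Omega> x * (blinfun_apply (\<phi>' x) i \<bullet> j))" for i j
  have div: "(LINT x|lborel. indicator \<Omega> x * divergence \<phi> x) = (\<Sum>b\<in>Basis. a b b)"
    unfolding a_def divergence_eq[OF der] sum_distrib_left
    by (intro Bochner_Integration.integral_sum ia)
  \<comment> \<open>The test function is the component of \<phi> along the unit vector u = y/|y|.
    Its derivative along y is the quadratic form at y divided by |y|, which is the source of the
    weight 1/|y|.\<close>
  have pointwise: "(\<Sum>i\<in>Basis. \<Sum>j\<in>Basis. ((y \<bullet> i) * (y \<bullet> j)) * a i j) / norm y - \<epsilon> * measure lborel \<Omega> * norm y \<le> 2 * escape \<Omega> y"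
    if y: "norm y < \<delta>0" for y
  proof (cases "y = 0")
    case True
    then show ?thesis using escape_bounds(1)[OF \<Omega> fin, of y] by simp
  next
    case False
    define u where "u = y /\<^sub>R norm y"
    have u: "norm u = 1" using False by (simp add: u_def)
    have f: "\<bar>\<phi> x \<bullet> u\<bar> \<le> 1" for x
      using Cauchy_Schwarz_ineq2[of "\<phi> x" u] bd[of x] u by simp
    have lower: "(blinfun_apply (\<phi>' x) y \<bullet> y) / norm y - \<epsilon> * norm y \<le> \<phi> (x + y) \<bullet> u - \<phi> x \<bullet> u" for x
    proof -
      have "norm (\<phi> (x + y) - \<phi> x - blinfun_apply (\<phi>' x) (x + y - x)) \<le> norm (x + y - x) * \<epsilon>"
      \<comment> \<open>Mean value inequality for \<phi> minus its linearisation at x; the segment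
        from x to x + y stays in the ball where the derivative varies by at most \<epsilon>.\<close>
      proof (rule differentiable_bound_linearization[where S = "ball x \<delta>0" and f' = "\<lambda>x. blinfun_apply (\<phi>' x)"])
        show "x + s *\<^sub>R (x + y - x) \<in> ball x \<delta>0" if "s \<in> {0..1}" for s
        proof -
          have "\<bar>s\<bar> * norm y \<le> 1 * norm y" using that by (intro mult_right_mono) auto
          then show ?thesis using y by (simp add: dist_norm)
        qed
        show "onorm (blinfun_apply (\<phi>' x') - blinfun_apply (\<phi>' x)) \<le> \<epsilon>" if "x' \<in> ball x \<delta>0" for x'
        proof -
          have "norm (\<phi>' x' - \<phi>' x) \<le> \<epsilon>"
            using \<delta>0(2)[of x' x] that by (simp add: dist_norm norm_minus_commute)
          then show ?thesis by (simp add: norm_blinfun.rep_eq minus_blinfun.rep_eq fun_diff_def)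
        qed
        show "(\<phi> has_derivative blinfun_apply (\<phi>' x')) (at x' within ball x \<delta>0)" for x'
          by (rule has_derivative_at_withinI[OF der])
      qed (use \<delta>0 in auto)
      then have n: "norm (\<phi> (x + y) - \<phi> x - blinfun_apply (\<phi>' x) y) \<le> \<epsilon> * norm y"
        by (simp add: mult.commute)
      have "\<bar>(\<phi> (x + y) - \<phi> x - blinfun_apply (\<phi>' x) y) \<bullet> u\<bar> \<le> \<epsilon> * norm y"
        using Cauchy_Schwarz_ineq2[of "\<phi> (x + y) - \<phi> x - blinfun_apply (\<phi>' x) y" u] u n by simp
      moreover have "blinfun_apply (\<phi>' x) y \<bullet> u = (blinfun_apply (\<phi>' x) y \<bullet> y) / norm y"
        by (simp add: u_def divide_inverse mult.commute)
      ultimately show ?thesis by (simp add: inner_diff_left)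
    qed
    have q: "indicator \<Omega> x * ((blinfun_apply (\<phi>' x) y \<bullet> y) / norm y) =
        (\<Sum>i\<in>Basis. \<Sum>j\<in>Basis. ((y \<bullet> i) * (y \<bullet> j)) / norm y * (indicator \<Omega> x * (blinfun_apply (\<phi>' x) i \<bullet> j)))" for x
      unfolding blinfun_quadratic_form by (simp add: sum_divide_distrib sum_distrib_left ac_simps)
    have iq: "integrable lborel (\<lambda>x. indicator \<Omega> x * ((blinfun_apply (\<phi>' x) y \<bullet> y) / norm y))"
      unfolding q by (intro Bochner_Integration.integrable_sum integrable_mult_right ia)
    let ?c = "\<lambda>i j x. ((y \<bullet> i) * (y \<bullet> j)) / norm y * (indicator \<Omega> x * (blinfun_apply (\<phi>' x) i \<bullet> j))"
    have "(LINT x|lborel. indicator \<Omega> x * ((blinfun_apply (\<phi>' x) y \<bullet> y) / norm y)) =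
        (\<Sum>i\<in>Basis. LINT x|lborel. (\<Sum>j\<in>Basis. ?c i j x))"
      unfolding q by (intro Bochner_Integration.integral_sum Bochner_Integration.integrable_sum integrable_mult_right ia)
    also have "\<dots> = (\<Sum>i\<in>Basis. \<Sum>j\<in>Basis. LINT x|lborel. ?c i j x)"
      by (intro sum.cong refl Bochner_Integration.integral_sum integrable_mult_right ia)
    also have "\<dots> = (\<Sum>i\<in>Basis. \<Sum>j\<in>Basis. ((y \<bullet> i) * (y \<bullet> j)) * a i j) / norm y"
      unfolding integral_mult_right_zero a_def[symmetric] by (simp add: sum_divide_distrib)
    finally have "(LINT x|lborel. indicator \<Omega> x * ((blinfun_apply (\<phi>' x) y \<bullet> y) / norm y)) =
        (\<Sum>i\<in>Basis. \<Sum>j\<in>Basis. ((y \<bullet> i) * (y \<bullet> j)) * a i j) / norm y" .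
    then have "(\<Sum>i\<in>Basis. \<Sum>j\<in>Basis. ((y \<bullet> i) * (y \<bullet> j)) * a i j) / norm y - \<epsilon> * measure lborel \<Omega> * norm y
      = (LINT x|lborel. indicator \<Omega> x * ((blinfun_apply (\<phi>' x) y \<bullet> y) / norm y)) - (LINT x|lborel. \<epsilon> * norm y * indicator \<Omega> x)"
      by (simp only: integral_mult_right_zero m\<Omega>) simp
    also have "\<dots> = (LINT x|lborel. indicator \<Omega> x * ((blinfun_apply (\<phi>' x) y \<bullet> y) / norm y) - \<epsilon> * norm y * indicator \<Omega> x)"
      by (rule Bochner_Integration.integral_diff[OF iq integrable_mult_right[OF i\<Omega>], symmetric])
    also have "\<dots> \<le> (LINT x|lborel. indicator \<Omega> x * (\<phi> (x + y) \<bullet> u - \<phi> x \<bullet> u))"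
    proof (rule integral_mono)
      show "integrable lborel (\<lambda>x. indicator \<Omega> x * ((blinfun_apply (\<phi>' x) y \<bullet> y) / norm y) - \<epsilon> * norm y * indicator \<Omega> x)"
        using iq i\<Omega> by (intro Bochner_Integration.integrable_diff integrable_mult_right)
      show "integrable lborel (\<lambda>x. indicator \<Omega> x * (\<phi> (x + y) \<bullet> u - \<phi> x \<bullet> u))"
      proof (rule Bochner_Integration.integrable_bound)
        show "integrable lborel (\<lambda>x. 2 * indicator \<Omega> x :: real)" using i\<Omega> by (rule integrable_mult_right)
        have "\<bar>\<phi> (x + y) \<bullet> u - \<phi> x \<bullet> u\<bar> \<le> 2" for x using f[of "x + y"] f[of x] by linarith
        then show "AE x in lborel. norm (indicator \<Omega> x * (\<phi> (x + y) \<bullet> u - \<phi> x \<bullet> u)) \<le> norm (2 * indicator \<Omega> x :: real)"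
          by (intro AE_I2) (auto simp: indicator_def)
      qed measurable
      show "indicator \<Omega> x * ((blinfun_apply (\<phi>' x) y \<bullet> y) / norm y) - \<epsilon> * norm y * indicator \<Omega> x
          \<le> indicator \<Omega> x * (\<phi> (x + y) \<bullet> u - \<phi> x \<bullet> u)" for x
        using lower[of x] by (auto simp: indicator_def)
    qed
    also have "\<dots> \<le> 2 * escape \<Omega> y"
      by (rule integral_increment_le_escape[OF \<Omega> fin, of "\<lambda>x. \<phi> x \<bullet> u"]) (use f in auto)
    finally show ?thesis .
  qed
  show thesis
  proof (rule that[OF \<delta>0(1)])
    fix \<mu> :: "'v measure" and \<delta> :: real
    assume \<mu>: "prob_space \<mu>" and sets: "sets \<mu> = sets borel" and inv: "rotation_invariant \<mu>"
      and \<delta>: "0 < \<delta>" "\<delta> \<le> \<delta>0"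
    interpret prob_space \<mu> by (rule \<mu>)
    note [measurable_cong] = sets
    let ?w = "\<lambda>y::'v. indicator {y. norm y < \<delta>} y / norm y :: real"
    let ?n = "\<lambda>y::'v. indicator {y. norm y < \<delta>} y * norm y :: real"
    note moment = truncated_quadratic_moment[OF inv sets finite_measure_axioms \<delta>(1)]
    have in_: "integrable \<mu> ?n"
      by (rule integrable_const_bound[of _ \<delta>]) (use \<delta> in \<open>auto simp: indicator_def intro!: AE_I2\<close>)
    have ie: "integrable \<mu> (\<lambda>y. 2 * escape \<Omega> y)"
    proof (intro integrable_mult_right integrable_const_bound[of _ "measure lborel \<Omega>"])
      show "escape \<Omega> \<in> borel_measurable \<mu>" using escape_measurable[OF \<Omega>] by simp
      show "AE y in \<mu>. norm (escape \<Omega> y) \<le> measure lborel \<Omega>"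
        using escape_bounds[OF \<Omega> fin] by (intro AE_I2) auto
    qed
    have is_: "integrable \<mu> (\<lambda>y. (\<Sum>i\<in>Basis. \<Sum>j\<in>Basis. ?w y * ((y \<bullet> i) * (y \<bullet> j)) * a i j))"
      by (intro Bochner_Integration.integrable_sum integrable_mult_left moment(1))
    have inner: "(LINT y|\<mu>. (\<Sum>j\<in>Basis. ?w y * ((y \<bullet> i) * (y \<bullet> j)) * a i j)) = (LINT y|\<mu>. ?n y) / real DIM('v) * a i i"
      if i: "i \<in> Basis" for i
    proof -
      have "(LINT y|\<mu>. (\<Sum>j\<in>Basis. ?w y * ((y \<bullet> i) * (y \<bullet> j)) * a i j))
          = (\<Sum>j\<in>Basis. LINT y|\<mu>. ?w y * ((y \<bullet> i) * (y \<bullet> j)) * a i j)"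
        by (intro Bochner_Integration.integral_sum integrable_mult_left moment(1) i)
      also have "\<dots> = (\<Sum>j\<in>Basis. (if i = j then (LINT y|\<mu>. ?n y) / real DIM('v) * a i i else 0))"
      proof (rule sum.cong[OF refl])
        fix j :: 'v assume j: "j \<in> Basis"
        show "(LINT y|\<mu>. ?w y * ((y \<bullet> i) * (y \<bullet> j)) * a i j) = (if i = j then (LINT y|\<mu>. ?n y) / real DIM('v) * a i i else 0)"
          unfolding integral_mult_left_zero moment(2)[OF i j] by simp
      qed
      also have "\<dots> = (LINT y|\<mu>. ?n y) / real DIM('v) * a i i" using i by simp
      finally show ?thesis .
    qed
    have "(LINT y|\<mu>. (\<Sum>i\<in>Basis. \<Sum>j\<in>Basis. ?w y * ((y \<bullet> i) * (y \<bullet> j)) * a i j))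
        = (\<Sum>i\<in>Basis. LINT y|\<mu>. (\<Sum>j\<in>Basis. ?w y * ((y \<bullet> i) * (y \<bullet> j)) * a i j))"
      by (intro Bochner_Integration.integral_sum Bochner_Integration.integrable_sum integrable_mult_left moment(1))
    also have "\<dots> = (LINT y|\<mu>. ?n y) / real DIM('v) * (\<Sum>i\<in>Basis. a i i)"
      using inner by (simp add: sum_distrib_left)
    finally have s: "(LINT y|\<mu>. (\<Sum>i\<in>Basis. \<Sum>j\<in>Basis. ?w y * ((y \<bullet> i) * (y \<bullet> j)) * a i j))
        = (LINT y|\<mu>. ?n y) / real DIM('v) * (\<Sum>i\<in>Basis. a i i)" .
    have "((LINT x|lborel. indicator \<Omega> x * divergence \<phi> x) / real DIM('v) - \<epsilon> * measure lborel \<Omega>) * (LINT y|\<mu>. ?n y)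
      = (LINT y|\<mu>. (\<Sum>i\<in>Basis. \<Sum>j\<in>Basis. ?w y * ((y \<bullet> i) * (y \<bullet> j)) * a i j) - \<epsilon> * measure lborel \<Omega> * ?n y)"
      unfolding div
      unfolding Bochner_Integration.integral_diff[OF is_ integrable_mult_right[OF in_]] s integral_mult_right_zero
      by (simp add: left_diff_distrib)
    also have "\<dots> \<le> (LINT y|\<mu>. 2 * escape \<Omega> y)"
    proof (rule integral_mono[OF _ ie])
      show "integrable \<mu> (\<lambda>y. (\<Sum>i\<in>Basis. \<Sum>j\<in>Basis. ?w y * ((y \<bullet> i) * (y \<bullet> j)) * a i j) - \<epsilon> * measure lborel \<Omega> * ?n y)"
        by (intro Bochner_Integration.integrable_diff is_ integrable_mult_right in_)
      \<comment> \<open>Outside the ball of radius \<delta> the left side vanishes and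
        \<open>escape\<close> is nonnegative, so large displacements are simply dropped.\<close>
      show "(\<Sum>i\<in>Basis. \<Sum>j\<in>Basis. ?w y * ((y \<bullet> i) * (y \<bullet> j)) * a i j) - \<epsilon> * measure lborel \<Omega> * ?n y \<le> 2 * escape \<Omega> y" for y
      proof (cases "norm y < \<delta>")
        case True
        have "(\<Sum>i\<in>Basis. \<Sum>j\<in>Basis. ?w y * ((y \<bullet> i) * (y \<bullet> j)) * a i j) = (\<Sum>i\<in>Basis. \<Sum>j\<in>Basis. ((y \<bullet> i) * (y \<bullet> j)) * a i j) / norm y"
          using True by (simp add: sum_divide_distrib)
        then show ?thesis using pointwise[of y] True \<delta> by simp
      next
        case False
        then show ?thesis using escape_bounds(1)[OF \<Omega> fin, of y] by simp
      qed
    qed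
    finally show "((LINT x|lborel. indicator \<Omega> x * divergence \<phi> x) / real DIM('v) - \<epsilon> * measure lborel \<Omega>) * (LINT y|\<mu>. ?n y)
        \<le> 2 * (LINT y|\<mu>. escape \<Omega> y)" by simp
  qed
qed

text \<open>Fubini in the starting point and the displacement; finite volume of \<Omega> gives
  integrability on the product.\<close>

lemma heat_loss_eq_escape:
  fixes X :: "real \<Rightarrow> 'w \<Rightarrow> 'v::euclidean_space"
  assumes M: "prob_space M" and X [measurable]: "X t \<in> borel_measurable M"
    and \<Omega> [measurable]: "\<Omega> \<in> sets borel" and fin: "emeasure lborel \<Omega> < \<infinity>"
  shows "heat_loss M X \<Omega> t = (LINT y|distr M borel (X t). escape \<Omega> y)"
proof -
  let ?\<mu> = "distr M borel (X t)"
  interpret prob_space M by (rule M)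
  interpret \<mu>: prob_space ?\<mu> by (rule prob_space_distr[OF X])
  interpret P: pair_sigma_finite lborel ?\<mu> ..
  have [measurable]: "- \<Omega> \<in> sets borel" using \<Omega> by (simp add: borel_comp)
  have i\<Omega>: "integrable lborel (indicator \<Omega> :: 'v \<Rightarrow> real)" using fin by simp
  have law: "measure (law_from M X x t) (- \<Omega>) = (LINT y|?\<mu>. indicator (- \<Omega>) (x + y))" for x
  proof -
    have "law_from M X x t = distr ?\<mu> borel (\<lambda>y. x + y)"
      unfolding law_from_def by (subst distr_distr) (auto simp: comp_def)
    then have "measure (law_from M X x t) (- \<Omega>) = (LINT z|distr ?\<mu> borel (\<lambda>y. x + y). indicator (- \<Omega>) z)"
      by simp
    also have "\<dots> = (LINT y|?\<mu>. indicator (- \<Omega>) (x + y))" by (rule integral_distr) auto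
    finally show ?thesis .
  qed
  have prod: "integrable (lborel \<Otimes>\<^sub>M ?\<mu>) (\<lambda>(x, y). indicator \<Omega> x * indicator (- \<Omega>) (x + y) :: real)"
  proof (rule P.Fubini_integrable)
    have b: "norm (LINT y|?\<mu>. indicator (- \<Omega>) (x + y) :: real) \<le> 1" for x
      unfolding law[symmetric] law_from_def
      using prob_space.prob_le_1[OF prob_space_distr, of "\<lambda>\<omega>. x + X t \<omega>" borel "- \<Omega>"] by simp
    have "integrable lborel (\<lambda>x. indicator \<Omega> x * (LINT y|?\<mu>. indicator (- \<Omega>) (x + y)) :: real)"
      by (rule Bochner_Integration.integrable_bound[OF i\<Omega>])
        (use b in \<open>auto simp: abs_mult intro!: AE_I2 mult_left_le\<close>)
    then show "integrable lborel (\<lambda>x. LINT y|?\<mu>. norm ((case (x, y) of (x, y) \<Rightarrow> indicator \<Omega> x * indicator (- \<Omega>) (x + y)) :: real))"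
      by (simp add: abs_mult)
    show "AE x in lborel. integrable ?\<mu> (\<lambda>y. (case (x, y) of (x, y) \<Rightarrow> indicator \<Omega> x * indicator (- \<Omega>) (x + y)) :: real)"
      by (intro AE_I2 \<mu>.integrable_const_bound[of _ 1]) (auto simp: indicator_def)
  qed measurable
  have "heat_loss M X \<Omega> t = (LINT x|lborel. LINT y|?\<mu>. indicator \<Omega> x * indicator (- \<Omega>) (x + y))"
    unfolding heat_loss_def set_lebesgue_integral_def law by simp
  also have "\<dots> = (LINT y|?\<mu>. LINT x|lborel. indicator \<Omega> x * indicator (- \<Omega>) (x + y))"
    by (rule P.Fubini_integral[OF prod, symmetric])
  finally show ?thesis unfolding escape_eq_integral[OF \<Omega>] .
qed

section \<open>Small times\<close>

lemma set_integrable_levy_h: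
  assumes "levy_measure \<nu>" "0 \<le> \<eta>" "0 < a"
  shows "set_integrable lborel {a..b} (levy_h \<eta> \<nu>)"
  unfolding set_integrable_def
proof (rule Bochner_Integration.integrable_bound)
  note [measurable] = levy_h_measurable[OF assms(1), of \<eta>]
  show "integrable lborel (\<lambda>r. levy_h \<eta> \<nu> a * indicator {a..b} r :: real)"
    by (intro integrable_mult_right) (simp add: integrable_indicator_iff emeasure_lborel_Icc_eq)
  show "AE r in lborel. norm (indicator {a..b} r *\<^sub>R levy_h \<eta> \<nu> r) \<le> norm (levy_h \<eta> \<nu> a * indicator {a..b} r :: real)"
    using levy_h_antimono[OF assms] levy_h_nonneg[OF assms(2), of \<nu>] by (intro AE_I2) (auto simp: indicator_def)
  show "(\<lambda>r. indicator {a..b} r *\<^sub>R levy_h \<eta> \<nu> r) \<in> borel_measurable lborel" by measurable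
qed

text \<open>The integral of a non-integrable function is 0 by convention, so divergence has to be
  phrased through truncated integrals. Were they all at most K, continuity from below of the measure
  with density f would make f integrable up to 0.\<close>

lemma set_integral_unbounded_near_zero:
  fixes f :: "real \<Rightarrow> real"
  assumes [measurable]: "f \<in> borel_measurable borel" and nonneg: "\<And>r. 0 \<le> f r"
    and int: "\<And>a. 0 < a \<Longrightarrow> set_integrable lborel {a..\<delta>} f"
    and not: "\<not> set_integrable lborel {0<..<\<delta>} f" and \<delta>: "0 < \<delta>"
  obtains a where "0 < a" "a < \<delta>" "K < (LINT r:{a..\<delta>}|lborel. f r)"
proof (rule ccontr)
  assume "\<not> thesis"
  then have le: "(LINT r:{a..\<delta>}|lborel. f r) \<le> K" if "0 < a" "a < \<delta>" for a
    using that \<open>\<And>a. 0 < a \<Longrightarrow> a < \<delta> \<Longrightarrow> K < (LINT r:{a..\<delta>}|lborel. f r) \<Longrightarrow> thesis\<close> by fastforce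
  \<comment> \<open>The shift by 2 keeps the left endpoint strictly below \<delta> already for n =
    0.\<close>
  define A where "A n = {\<delta> / real (n + 2)..\<delta>}" for n :: nat
  define N where "N = density lborel (\<lambda>r. ennreal (f r))"
  have small: "0 < \<delta> / real (n + 2)" "\<delta> / real (n + 2) < \<delta>" for n
    using \<delta> by (simp_all add: divide_less_eq)
  have inc: "incseq A"
    unfolding incseq_def A_def
  proof (intro allI impI)
    fix m n :: nat assume "m \<le> n"
    then have "\<delta> / real (n + 2) \<le> \<delta> / real (m + 2)" using \<delta> by (intro divide_left_mono) auto
    then show "{\<delta> / real (m + 2)..\<delta>} \<subseteq> {\<delta> / real (n + 2)..\<delta>}" by auto
  qed
  have N_A: "emeasure N (A n) \<le> ennreal K" for n
  proof -
    have i: "integrable lborel (\<lambda>r. indicator (A n) r * f r)"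
      using int[OF small(1)[of n]] by (simp add: set_integrable_def A_def)
    have "emeasure N (A n) = (\<integral>\<^sup>+ r. ennreal (indicator (A n) r * f r) \<partial>lborel)"
      unfolding N_def by (subst emeasure_density)
        (auto simp: A_def indicator_def intro!: nn_integral_cong)
    also have "\<dots> = ennreal (LINT r|lborel. indicator (A n) r * f r)"
      using nonneg by (intro nn_integral_eq_integral i) auto
    also have "\<dots> \<le> ennreal K"
      using le[OF small[of n]] by (intro ennreal_leI) (simp add: A_def set_lebesgue_integral_def)
    finally show ?thesis .
  qed
  have cover: "{0<..<\<delta>} \<subseteq> (\<Union>n. A n)"
  proof
    fix r assume r: "r \<in> {0<..<\<delta>}"
    obtain n where "\<delta> / r < real n" using reals_Archimedean2 by blast
    then have "\<delta> \<le> r * real (n + 2)" using r by (simp add: divide_less_eq field_simps)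
    then show "r \<in> (\<Union>n. A n)" using r by (auto simp: A_def divide_le_eq intro!: exI[of _ n])
  qed
  have "emeasure N {0<..<\<delta>} \<le> emeasure N (\<Union>n. A n)"
    using cover by (intro emeasure_mono) (auto simp: N_def A_def)
  also have "\<dots> = (SUP n. emeasure N (A n))"
  proof (rule SUP_emeasure_incseq[symmetric])
    show "range A \<subseteq> sets N" by (auto simp: N_def A_def)
  qed (rule inc)
  also have "\<dots> \<le> ennreal K" using N_A by (intro SUP_least)
  finally have fin: "emeasure N {0<..<\<delta>} < \<infinity>" using ennreal_less_top le_less_trans by (metis infinity_ennreal_def)
  have "emeasure N {0<..<\<delta>} = (\<integral>\<^sup>+ r. ennreal (norm (indicator {0<..<\<delta>} r *\<^sub>R f r)) \<partial>lborel)"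
    unfolding N_def using nonneg by (subst emeasure_density)
      (auto simp: indicator_def intro!: nn_integral_cong)
  then have "set_integrable lborel {0<..<\<delta>} f"
    unfolding set_integrable_def using fin by (intro integrableI_bounded) auto
  then show False using not by simp
qed

text \<open>The supremum in \<open>levy_h_inv\<close> is meaningful only for a nonempty set bounded
  above. Non-integrability gives the first, since a bounded h would be integrable on (0,1);
  monotonicity of h gives the second.\<close>

lemma levy_h_inv_eventually:
  assumes \<nu>: "levy_measure \<nu>" and \<eta>: "0 \<le> \<eta>"
    and not: "\<And>\<delta>. \<delta> > 0 \<Longrightarrow> \<not> set_integrable lborel {0<..<\<delta>} (levy_h \<eta> \<nu>)" and \<epsilon>: "0 < \<epsilon>"
  shows "\<forall>\<^sub>F t in at_right 0. 0 < t \<and> 0 < levy_h_inv \<eta> \<nu> (1 / t) \<and> levy_h_inv \<eta> \<nu> (1 / t) \<le> \<epsilon>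
     \<and> (\<forall>r > levy_h_inv \<eta> \<nu> (1 / t). t * levy_h \<eta> \<nu> r \<le> 1)"
proof -
  have h0: "0 \<le> levy_h \<eta> \<nu> r" for r by (rule levy_h_nonneg[OF \<eta>])
  \<comment> \<open>For t below this threshold h(\<epsilon>) < 1/t, so every r in the set lies below
    \<epsilon>; the added 1 guards against h(\<epsilon>) = 0.\<close>
  have pos: "0 < 1 / (levy_h \<eta> \<nu> \<epsilon> + 1)" using h0[of \<epsilon>] by simp
  show ?thesis
    using eventually_at_right_real[OF pos]
  proof eventually_elim
    case (elim t)
    let ?S = "{r. r > 0 \<and> levy_h \<eta> \<nu> r \<ge> 1 / t}"
    have t: "0 < t" "levy_h \<eta> \<nu> \<epsilon> < 1 / t"
      using elim h0[of \<epsilon>] by (auto simp: field_simps)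
    have le: "r \<le> \<epsilon>" if "r \<in> ?S" for r
      using levy_h_antimono[OF \<nu> \<eta> \<epsilon>, of r] that t by (cases "\<epsilon> \<le> r") auto
    have ne: "?S \<noteq> {}"
    proof
      assume "?S = {}"
      then have bd: "levy_h \<eta> \<nu> r \<le> 1 / t" if "0 < r" for r using that by (auto simp: not_le less_imp_le)
      have "set_integrable lborel {0<..<1} (levy_h \<eta> \<nu>)"
        unfolding set_integrable_def
      proof (rule Bochner_Integration.integrable_bound)
        note [measurable] = levy_h_measurable[OF \<nu>, of \<eta>]
        show "integrable lborel (\<lambda>r::real. 1 / t * indicator {0<..<1} r :: real)"
          by (intro integrable_mult_right) (simp add: integrable_indicator_iff)
        show "AE r in lborel. norm (indicator {0<..<1} r *\<^sub>R levy_h \<eta> \<nu> r) \<le> norm (1 / t * indicator {0<..<1} r :: real)"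
          using bd h0 t by (intro AE_I2) (auto simp: indicator_def)
        show "(\<lambda>r. indicator {0<..<1} r *\<^sub>R levy_h \<eta> \<nu> r) \<in> borel_measurable lborel" by measurable
      qed
      then show False using not[of 1] by simp
    qed
    then obtain r0 where r0: "r0 \<in> ?S" by blast
    have bdd: "bdd_above ?S" using le by (intro bdd_aboveI) auto
    have "0 < Sup ?S" using cSup_upper[OF r0 bdd] r0 by auto
    moreover have "Sup ?S \<le> \<epsilon>" using ne le by (intro cSup_least)
    moreover have "t * levy_h \<eta> \<nu> r \<le> 1" if r: "Sup ?S < r" for r
    proof -
      have "r \<notin> ?S" using cSup_upper[OF _ bdd, of r] r by fastforce
      then have "levy_h \<eta> \<nu> r < 1 / t" using r \<open>0 < Sup ?S\<close> by auto
      then show ?thesis using t by (simp add: field_simps)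
    qed
    ultimately show ?case using t(1) unfolding levy_h_inv_def by blast
  qed
qed

text \<open>The zero field is admissible. This excludes minus infinity, so that a finite perimeter
  equals its real part.\<close>

lemma perimeter_nonneg: "0 \<le> perimeter (\<Omega> :: 'v::euclidean_space set)"
  unfolding perimeter_def
proof (rule SUP_upper2)
  have d: "((\<lambda>_. 0 :: 'v) has_derivative blinfun_apply 0) (at x)" for x :: 'v
    by (simp add: zero_blinfun.rep_eq)
  then have "C1 (\<lambda>_. 0 :: 'v)" unfolding C1_def by (intro exI[of _ "\<lambda>_. 0"]) auto
  then show "(\<lambda>_. 0) \<in> {\<phi> :: 'v \<Rightarrow> 'v. C1 \<phi> \<and> compact (closure {x. \<phi> x \<noteq> 0}) \<and> (\<forall>x. norm (\<phi> x) \<le> 1)}"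
    by simp
  have "divergence (\<lambda>_. 0 :: 'v) x = 0" for x by (subst divergence_eq[OF d]) simp
  then show "0 \<le> ereal (LINT x|lborel. indicator \<Omega> x * divergence (\<lambda>_. 0 :: 'v) x)" by simp
qed

lemma measure_lborel_open_pos:
  fixes \<Omega> :: "'v::euclidean_space set"
  assumes "open \<Omega>" "\<Omega> \<noteq> {}" "emeasure lborel \<Omega> < \<infinity>"
  shows "0 < measure lborel \<Omega>"
proof -
  obtain x e where e: "0 < e" "ball x e \<subseteq> \<Omega>" using assms open_contains_ball by blast
  have "0 < measure lborel (ball x e)" using e(1) by (rule content_ball_pos)
  also have "\<dots> \<le> measure lborel \<Omega>"
    using assms e by (intro measure_mono_fmeasurable) (auto simp: fmeasurable_def)
  finally show ?thesis .
qed

lemma levy_law_distr: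
  fixes X :: "real \<Rightarrow> 'w \<Rightarrow> 'v::euclidean_space"
  assumes levy: "levy_process M X"
    and exponent: "characteristic_exponent M X (\<lambda>\<xi>. complex_of_real (\<psi> (norm \<xi>)))"
    and rep: "isotropic_levy_khintchine \<eta> \<nu> (\<lambda>\<xi>. \<psi> (norm \<xi>))"
    and t: "0 \<le> t"
  shows "levy_law (distr M borel (X t)) \<psi> \<eta> \<nu> t"
proof -
  interpret levy_process M X by (rule levy)
  have [measurable]: "X t \<in> borel_measurable M" using random_variable t .
  interpret \<mu>: prob_space "distr M borel (X t)" by (rule prob_space_distr) measurable
  show ?thesis
  proof unfold_locales
    fix \<xi> :: 'v
    have i: "integrable M (\<lambda>\<omega>. exp (\<i> * complex_of_real (X t \<omega> \<bullet> \<xi>)))"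
      by (rule integrable_const_bound[of _ 1]) auto
    have "(LINT y|distr M borel (X t). cos (y \<bullet> \<xi>)) = (LINT \<omega>|M. cos (X t \<omega> \<bullet> \<xi>))"
      by (rule integral_distr) measurable
    also have "\<dots> = (LINT \<omega>|M. Re (exp (\<i> * complex_of_real (X t \<omega> \<bullet> \<xi>))))"
      by (simp add: Re_exp)
    also have "\<dots> = Re (LINT \<omega>|M. exp (\<i> * complex_of_real (X t \<omega> \<bullet> \<xi>)))"
      using i by simp
    also have "\<dots> = Re (exp (- (complex_of_real t * complex_of_real (\<psi> (norm \<xi>)))))"
      using exponent t unfolding characteristic_exponent_def by simp
    also have "\<dots> = exp (- (t * \<psi> (norm \<xi>)))"
      by (simp add: Re_exp)
    finally show "(LINT y|distr M borel (X t). cos (y \<bullet> \<xi>)) = exp (- (t * \<psi> (norm \<xi>)))" .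
  qed (use t rep in auto)
qed

theorem proposition2:
  fixes M :: "'w measure"
    and X :: "real \<Rightarrow> 'w \<Rightarrow> 'v::euclidean_space"
    and \<psi> :: "real \<Rightarrow> real"
    and \<eta> :: real and \<nu> :: "'v measure"
    and C0 \<alpha> :: real
  assumes levy: "levy_process M X"
    and isotropic: "isotropic M X"
    and exponent: "characteristic_exponent M X (\<lambda>\<xi>. complex_of_real (\<psi> (norm \<xi>)))"
    and representation: "isotropic_levy_khintchine \<eta> \<nu> (\<lambda>\<xi>. \<psi> (norm \<xi>))"
    and C0: "C0 > 0"
    and alpha: "0 < \<alpha>" "\<alpha> < 2"
    and scaling: "\<And>x y. 1 < x \<Longrightarrow> x < y \<Longrightarrow>
          inverse C0 * \<psi> x \<le> \<psi> y \<and> \<psi> y \<le> C0 * (y / x) powr \<alpha> * \<psi> x"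
    and not_integrable: "\<And>\<delta>. \<delta> > 0 \<Longrightarrow> \<not> set_integrable lborel {0<..<\<delta>} (levy_h \<eta> \<nu>)"
  shows "\<exists>C>0. \<forall>\<Omega> :: 'v set.
           open \<Omega> \<longrightarrow> \<Omega> \<noteq> {} \<longrightarrow> emeasure lborel \<Omega> < \<infinity> \<longrightarrow> perimeter \<Omega> < \<infinity> \<longrightarrow>
           (let Per = real_of_ereal (perimeter \<Omega>);
                R = 2 * measure lborel \<Omega> / Per
            in \<forall>\<^sub>F t in at_right 0.
                 heat_loss M X \<Omega> t
                   \<ge> C * t * Per * (LBINT r=levy_h_inv \<eta> \<nu> (1 / t)..R. levy_h \<eta> \<nu> r))"
proof -
  interpret levy_process M X by (rule levy)
  have \<nu>: "levy_measure \<nu>" and \<eta>: "0 \<le> \<eta>" using representation by (auto simp: isotropic_levy_khintchine_def)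
  let ?h = "levy_h \<eta> \<nu>" and ?a = "\<lambda>t. levy_h_inv \<eta> \<nu> (1 / t)"
  let ?\<mu> = "\<lambda>t. distr M borel (X t)"
  define d where "d = real DIM('v)"
  have d: "0 < d" by (simp add: d_def)
  have h0: "0 \<le> ?h r" for r by (rule levy_h_nonneg[OF \<eta>])
  note int_h = set_integrable_levy_h[OF \<nu> \<eta>]
  have mono: "(LINT r:{b..\<delta>}|lborel. ?h r) \<le> (LINT r:{a..\<delta>}|lborel. ?h r)" if "0 < a" "a \<le> b" for a b \<delta>
    unfolding set_lebesgue_integral_def
    by (rule integral_mono) (use that h0 int_h[of a \<delta>] int_h[of b \<delta>] in \<open>auto simp: set_integrable_def indicator_def\<close>)
  \<comment> \<open>3072 d^2 is 8d * 384d: the heat loss is at least Per/(8d) times the truncated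
    first moment, and t times the integral of h is at most 384d times that moment.\<close>
  have "\<forall>\<^sub>F t in at_right 0. 1 / (3072 * d\<^sup>2) * t * Per * (LBINT r=?a t..R. ?h r) \<le> heat_loss M X \<Omega> t"
    if \<Omega>: "open \<Omega>" "\<Omega> \<noteq> {}" and fin: "emeasure lborel \<Omega> < \<infinity>" and per: "perimeter \<Omega> < \<infinity>"
      and Per: "Per = real_of_ereal (perimeter \<Omega>)" and R: "R = 2 * measure lborel \<Omega> / Per"
    for \<Omega> :: "'v set" and Per R
  proof -
    have \<Omega>_borel: "\<Omega> \<in> sets borel" using \<Omega>(1) by simp
    have loss: "heat_loss M X \<Omega> t = (LINT y|?\<mu> t. escape \<Omega> y)" if "0 \<le> t" for t
      by (rule heat_loss_eq_escape[where X = X and t = t, OF prob_space_axioms random_variable[OF that] \<Omega>_borel fin])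
    have per_eq: "perimeter \<Omega> = ereal Per"
      unfolding Per using per perimeter_nonneg[of \<Omega>] by (simp add: ereal_real)
    then have "0 \<le> Per" using perimeter_nonneg[of \<Omega>] by simp
    show ?thesis
    proof (cases "Per = 0")
      case True
      \<comment> \<open>With zero perimeter the claimed lower bound is 0, whatever value R
        takes.\<close>
      have "0 \<le> heat_loss M X \<Omega> t" if "0 \<le> t" for t
        unfolding loss[OF that] using escape_bounds(1)[OF \<Omega>_borel fin] by (intro Bochner_Integration.integral_nonneg)
      then show ?thesis using True by (auto simp: eventually_at_filter)
    next
      case False
      with \<open>0 \<le> Per\<close> have Per_pos: "0 < Per" by simp
      let ?V = "measure lborel \<Omega>"
      have V: "0 < ?V" by (rule measure_lborel_open_pos[OF \<Omega> fin])
      have R_pos: "0 < R" using V Per_pos by (simp add: R)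
      have "ereal (Per / 2) < perimeter \<Omega>" using Per_pos by (simp add: per_eq)
      then obtain \<phi> :: "'v \<Rightarrow> 'v" where \<phi>: "C1 \<phi>" "compact (closure {x. \<phi> x \<noteq> 0})" "\<And>x. norm (\<phi> x) \<le> 1"
        and p: "Per / 2 < (LINT x|lborel. indicator \<Omega> x * divergence \<phi> x)"
        unfolding perimeter_def less_SUP_iff by auto
      \<comment> \<open>Half the perimeter is retained by \<phi>, giving Per/(2d) after the trace;
        \<epsilon> is chosen so that the linearisation error takes exactly half of this.\<close>
      define \<epsilon> where "\<epsilon> = Per / (4 * d * ?V)"
      have \<epsilon>: "0 < \<epsilon>" using Per_pos V d by (simp add: \<epsilon>_def)
      obtain \<delta>0 where \<delta>0: "0 < \<delta>0" and average:
        "\<And>\<mu> \<delta>. prob_space \<mu> \<Longrightarrow> sets \<mu> = sets borel \<Longrightarrow> rotation_invariant \<mu> \<Longrightarrow> 0 < \<delta> \<Longrightarrow> \<delta> \<le> \<delta>0 \<Longrightarrow>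
          ((LINT x|lborel. indicator \<Omega> x * divergence \<phi> x) / real DIM('v) - \<epsilon> * ?V)
            * (LINT y|\<mu>. indicator {y. norm y < \<delta>} y * norm y) \<le> 2 * (LINT y|\<mu>. escape \<Omega> y)"
        using escape_average_ge[OF \<Omega>_borel fin \<phi> \<epsilon>] by blast
      \<comment> \<open>The bound by R lets the integral of h up to R be split at \<delta>.\<close>
      define \<delta> where "\<delta> = min \<delta>0 R"
      have \<delta>: "0 < \<delta>" "\<delta> \<le> \<delta>0" "\<delta> \<le> R" using \<delta>0 R_pos by (auto simp: \<delta>_def)
      let ?m = "\<lambda>t. LINT y|?\<mu> t. indicator {y. norm y < \<delta>} y * norm y"
      let ?I = "\<lambda>a. LINT r:{a..\<delta>}|lborel. ?h r"
      let ?K = "LINT r:{\<delta>..R}|lborel. ?h r"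
      \<comment> \<open>t * B is the contribution of displacements beyond \<delta> in the bound for
        the integral of h.\<close>
      define B where "B = 16 * d * \<delta> * ?h \<delta>"
      \<comment> \<open>Below \<open>a0\<close> the integral of h up to \<delta> exceeds both error
        terms together. This choice depends on \<Omega> and decides how small t must be.\<close>
      obtain a0 where a0: "0 < a0" "a0 < \<delta>" "384 * d * B + ?K < ?I a0"
        using set_integral_unbounded_near_zero[OF levy_h_measurable[OF \<nu>] h0 int_h not_integrable[OF \<delta>(1)] \<delta>(1)] by blast
      have "\<forall>\<^sub>F t in at_right 0. 0 < t \<and> 0 < ?a t \<and> ?a t \<le> a0 \<and> (\<forall>r > ?a t. t * ?h r \<le> 1)"
        by (rule levy_h_inv_eventually[OF \<nu> \<eta> _ a0(1)]) (rule not_integrable)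
      then show ?thesis
      proof eventually_elim
        case (elim t)
        then have t: "0 < t" and a: "0 < ?a t" "?a t \<le> a0"
          and small: "\<And>r. ?a t < r \<Longrightarrow> t * ?h r \<le> 1" by auto
        interpret L: levy_law "?\<mu> t" \<psi> \<eta> \<nu> t
          using levy_law_distr[OF levy exponent representation] t by simp
        have inv: "rotation_invariant (?\<mu> t)" using isotropic t by (simp add: isotropic_def)
        have m0: "0 \<le> ?m t" by (intro Bochner_Integration.integral_nonneg) simp
        have "Per / (4 * d) * ?m t \<le> ((LINT x|lborel. indicator \<Omega> x * divergence \<phi> x) / d - \<epsilon> * ?V) * ?m t"
        proof (intro mult_right_mono m0)
          have "Per / 2 / d \<le> (LINT x|lborel. indicator \<Omega> x * divergence \<phi> x) / d"
            using p d by (intro divide_right_mono) auto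
          moreover have "\<epsilon> * ?V = Per / (4 * d)" using V by (simp add: \<epsilon>_def)
          ultimately show "Per / (4 * d) \<le> (LINT x|lborel. indicator \<Omega> x * divergence \<phi> x) / d - \<epsilon> * ?V"
            by (simp add: field_simps)
        qed
        also have "\<dots> \<le> 2 * heat_loss M X \<Omega> t"
          using average[OF L.prob_space_axioms L.sets_law inv \<delta>(1,2)] t by (simp add: loss d_def)
        finally have H: "Per / (8 * d) * ?m t \<le> heat_loss M X \<Omega> t" by (simp add: field_simps)
        have I_large: "384 * d * B + ?K \<le> ?I (?a t)"
          using a0(3) mono[OF a, of \<delta>] by linarith
        have "t * ?I (?a t) \<le> 192 * d * (?m t + t * B)"
          using L.integral_levy_h_le[OF a(1), of \<delta>] a a0(2) small by (simp add: d_def B_def ac_simps)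
        then have m: "t * (?I (?a t) - 192 * d * B) \<le> 192 * d * ?m t" by (simp add: algebra_simps)
        \<comment> \<open>The interval integral is oriented; it equals the one over the closed
          interval because \<open>?a t\<close> is below R.\<close>
        have "(LBINT r=?a t..R. ?h r) = (LINT r:{?a t..R}|lborel. ?h r)"
          using a a0(2) \<delta>(3) by (intro interval_integral_Icc) simp
        also have "\<dots> \<le> ?I (?a t) + ?K"
        proof -
          have "(LINT r:{?a t..R}|lborel. ?h r) \<le> (LINT r|lborel. indicator {?a t..\<delta>} r *\<^sub>R ?h r + indicator {\<delta>..R} r *\<^sub>R ?h r)"
            unfolding set_lebesgue_integral_def
          proof (rule integral_mono)
            show "integrable lborel (\<lambda>r. indicator {?a t..R} r *\<^sub>R ?h r)"
              using int_h[OF a(1)] by (simp add: set_integrable_def)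
            show "integrable lborel (\<lambda>r. indicator {?a t..\<delta>} r *\<^sub>R ?h r + indicator {\<delta>..R} r *\<^sub>R ?h r)"
              using int_h[OF a(1)] int_h[OF \<delta>(1)] by (intro Bochner_Integration.integrable_add) (simp_all add: set_integrable_def)
            show "indicator {?a t..R} r *\<^sub>R ?h r \<le> indicator {?a t..\<delta>} r *\<^sub>R ?h r + indicator {\<delta>..R} r *\<^sub>R ?h r" for r
              using h0[of r] by (auto simp: indicator_def)
          qed
          also have "\<dots> = ?I (?a t) + ?K"
            unfolding set_lebesgue_integral_def
            using int_h[OF a(1)] int_h[OF \<delta>(1)] by (intro Bochner_Integration.integral_add) (simp_all add: set_integrable_def)
          finally show ?thesis .
        qed
        \<comment> \<open>Equivalent to \<open>384 * d * B + ?K \<le> ?I (?a t)\<close>; doubling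
          the constant thus absorbs the tail beyond \<delta> and the piece of the integral from
          \<delta> to R at once.\<close>
        also have "\<dots> \<le> 2 * (?I (?a t) - 192 * d * B)" using I_large by (simp add: right_diff_distrib)
        finally have "t * (LBINT r=?a t..R. ?h r) \<le> t * (2 * (?I (?a t) - 192 * d * B))"
          using t by (intro mult_left_mono) auto
        also have "\<dots> \<le> 384 * d * ?m t" using m by (simp add: algebra_simps)
        finally have "Per / (3072 * d\<^sup>2) * (t * (LBINT r=?a t..R. ?h r)) \<le> Per / (3072 * d\<^sup>2) * (384 * d * ?m t)"
          using Per_pos d by (intro mult_left_mono) auto
        also have "\<dots> = Per / (8 * d) * ?m t" using d by (simp add: power2_eq_square)
        also note H
        finally show ?case by (simp add: ac_simps)
      qed
    qed
  qed
  then show ?thesis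
    using d by (intro exI[of _ "1 / (3072 * d\<^sup>2)"]) (simp add: Let_def)
qed

end
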